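(* Let $X=\mathbb{P}^1\times\mathbb{P}^1$ over $\mathbb{C}$. (1) Let $I$ be the radical bi-homogeneous ideal of a finite set $Z=\{P_1,\dots,P_s\}$ of points in $X$. Assume that $$\alpha^{*}(I^{(6)})=\alpha^{*}(I^{(5)})+1=\alpha^{*}(I^{(4)})+2=\alpha^{*}(I^{(3)})+3=\alpha^{*}(I^{(2)})+4=\alpha^{*}(I)+5.$$ Then $\alpha^{*}(I)=1$, i.e. $Z$ is contained in a divisor of bi-degree $(1,1)$. (2) The sequence of equalities in (1) cannot be shortened in general: there exists a finite set $Z$ of points in $X$, with radical ideal $I$, such that $$\alpha^{*}(I^{(5)})=\alpha^{*}(I^{(4)})+1=\alpha^{*}(I^{(3)})+2=\alpha^{*}(I^{(2)})+3=\alpha^{*}(I)+4,$$ but $Z$ is not contained in any divisor of bi-degree $(1,1)$.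
   Context: $\mathbb{C}[X]=\mathbb{C}[x_0,x_1;y_0,y_1]$ is the bigraded coordinate ring of $X=\mathbb{P}^1\times\mathbb{P}^1$, and $\mathcal{O}_X(a,b)$ is the line bundle of bi-degree $(a,b)$. For a point $P=([a:b],[c:d])$, $I(P)$ is the prime ideal generated by $bx_0-ax_1$ and $dy_0-cy_1$. For $Z=\{P_1,\dots,P_s\}$ the radical ideal is $I=\bigcap_{i=1}^s I(P_i)$, and its $m$-th symbolic power is $I^{(m)}=\bigcap_{i=1}^s I(P_i)^m$; thus a bi-homogeneous form lies in $I^{(m)}$ exactly when it vanishes to order at least $m$ at each $P_i$. For a non-zero bi-homogeneous ideal $J\subset\mathbb{C}[X]$, $\alpha^{*}(J)$ is the least integer $k\ge 0$ such that $J$ contains a non-zero form of bi-degree $(k,k)$, i.e. $H^0(\mathcal{O}_X(k,k)\otimes J)\neq 0$. *)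

theory Defs
  imports Complex_Main "HOL-Library.Poly_Mapping"
begin

section \<open>Ideals in commutative rings\<close>

text \<open>An ideal is a submodule of the ring regarded as a module over itself. The locale
  \<open>module\<close> is not interpreted globally for multiplication: its simp rule \<open>scale_scale\<close> would
  reassociate products to the left and loop with \<open>algebra_simps\<close>.\<close>

lemma module_mult: "module ((*) :: 'a \<Rightarrow> 'a \<Rightarrow> 'a::comm_ring_1)"
  by standard (simp_all add: algebra_simps)

abbreviation ideal_gen :: "'a::comm_ring_1 set \<Rightarrow> 'a set" where
  "ideal_gen S \<equiv> module.span (*) S"

fun ideal_power :: "'a::comm_ring_1 set \<Rightarrow> nat \<Rightarrow> 'a set" where
  "ideal_power J 0 = UNIV"
| "ideal_power J (Suc m) = ideal_gen {f * g | f g. f \<in> J \<and> g \<in> ideal_power J m}"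

section \<open>The bigraded coordinate ring of the product of two projective lines\<close>

datatype var = X0 | X1 | Y0 | Y1

type_synonym coord_ring = "(var \<Rightarrow>\<^sub>0 nat) \<Rightarrow>\<^sub>0 complex"

definition Var :: "var \<Rightarrow> coord_ring" where
  "Var v = Poly_Mapping.single (Poly_Mapping.single v 1) 1"

definition Const :: "complex \<Rightarrow> coord_ring" where
  "Const c = Poly_Mapping.single 0 c"

text \<open>A form of bi-degree \<open>(k, l)\<close>; the zero polynomial is a form of every bi-degree.\<close>

definition form_of_bidegree :: "nat \<Rightarrow> nat \<Rightarrow> coord_ring \<Rightarrow> bool" where
  "form_of_bidegree k l F \<longleftrightarrow>
     (\<forall>t \<in> Poly_Mapping.keys F.
        Poly_Mapping.lookup t X0 + Poly_Mapping.lookup t X1 = k \<and>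
        Poly_Mapping.lookup t Y0 + Poly_Mapping.lookup t Y1 = l)"

definition eval :: "coord_ring \<Rightarrow> complex \<times> complex \<Rightarrow> complex \<times> complex \<Rightarrow> complex" where
  "eval F x y =
     (\<Sum>t \<in> Poly_Mapping.keys F. Poly_Mapping.lookup F t *
        (fst x ^ Poly_Mapping.lookup t X0 * snd x ^ Poly_Mapping.lookup t X1 *
         fst y ^ Poly_Mapping.lookup t Y0 * snd y ^ Poly_Mapping.lookup t Y1))"

section \<open>Points\<close>

definition proj_rel :: "complex \<times> complex \<Rightarrow> complex \<times> complex \<Rightarrow> bool" where
  "proj_rel u v \<longleftrightarrow> u \<noteq> (0, 0) \<and> v \<noteq> (0, 0) \<and>
     (\<exists>c. c \<noteq> 0 \<and> fst v = c * fst u \<and> snd v = c * snd u)"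

lemma proj_rel_refl: "u \<noteq> (0, 0) \<Longrightarrow> proj_rel u u"
  unfolding proj_rel_def by (intro conjI exI[of _ "1::complex"]) simp_all

lemma part_equivp_proj_rel: "part_equivp proj_rel"
proof (rule part_equivpI)
  show "\<exists>x. proj_rel x x"
    by (rule exI[of _ "(1, 0)"], rule proj_rel_refl) simp
  show "symp proj_rel"
  proof (rule sympI)
    fix u v assume "proj_rel u v"
    then obtain c where uv: "u \<noteq> (0, 0)" "v \<noteq> (0, 0)"
      and c: "c \<noteq> 0" "fst v = c * fst u" "snd v = c * snd u"
      unfolding proj_rel_def by (elim conjE exE)
    have "fst u = inverse c * fst v" "snd u = inverse c * snd v" "inverse c \<noteq> 0"
      unfolding c(2,3) using c(1) by simp_all
    with uv show "proj_rel v u"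
      unfolding proj_rel_def by (intro conjI exI[of _ "inverse c"])
  qed
  show "transp proj_rel"
  proof (rule transpI)
    fix u v w assume "proj_rel u v" "proj_rel v w"
    then obtain c d where uw: "u \<noteq> (0, 0)" "w \<noteq> (0, 0)" and cd: "c \<noteq> 0" "d \<noteq> 0"
      and e: "fst v = c * fst u" "snd v = c * snd u" "fst w = d * fst v" "snd w = d * snd v"
      unfolding proj_rel_def by (elim conjE exE)
    have "fst w = d * c * fst u" "snd w = d * c * snd u" "d * c \<noteq> 0"
      unfolding e using cd by simp_all
    with uw show "proj_rel u w"
      unfolding proj_rel_def by (intro conjI exI[of _ "d * c"])
  qed
qed

quotient_type proj_line = "complex \<times> complex" / partial: proj_rel
  by (rule part_equivp_proj_rel)

type_synonym point = "proj_line \<times> proj_line"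

text \<open>\<open>[a : b]\<close> is meaningful only for \<open>(a, b) \<noteq> (0, 0)\<close>.\<close>

definition hcoords :: "complex \<Rightarrow> complex \<Rightarrow> proj_line" where
  "hcoords a b = abs_proj_line (a, b)"

lemma span_subset_of_unit_multiple:
  assumes "proj_rel u v"
  shows "ideal_gen ({Const (snd u) * Var i - Const (fst u) * Var j} \<union> S)
       \<subseteq> ideal_gen ({Const (snd v) * Var i - Const (fst v) * Var j} \<union> S)"
proof -
  obtain c where c: "c \<noteq> 0" "fst v = c * fst u" "snd v = c * snd u"
    using assms by (auto simp: proj_rel_def)
  let ?G = "Const (snd v) * Var i - Const (fst v) * Var j"
  have u: "fst u = inverse c * fst v" "snd u = inverse c * snd v"
    unfolding c(2,3) using c(1) by simp_all
  have m: "Const (a * b) = Const a * Const b" for a b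
    by (simp add: Const_def mult_single)
  have "Const (snd u) * Var i - Const (fst u) * Var j = Const (inverse c) * ?G"
    by (simp only: u m right_diff_distrib mult.assoc)
  moreover have "Const (inverse c) * ?G \<in> ideal_gen ({?G} \<union> S)"
    by (intro module.span_scale[OF module_mult] module.span_base[OF module_mult]) simp
  moreover have "S \<subseteq> ideal_gen ({?G} \<union> S)"
    using module.span_superset[OF module_mult, of "{?G} \<union> S"] by blast
  ultimately show ?thesis
    by (intro module.span_minimal[OF module_mult] module.subspace_span[OF module_mult]) simp
qed

lift_definition point_ideal_aux :: "proj_line \<Rightarrow> proj_line \<Rightarrow> coord_ring set" is
  "\<lambda>u v. ideal_gen {Const (snd u) * Var X0 - Const (fst u) * Var X1,
                     Const (snd v) * Var Y0 - Const (fst v) * Var Y1}"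
proof -
  fix u u' v v' :: "complex \<times> complex"
  assume u: "proj_rel u u'" and v: "proj_rel v v'"
  have u2: "proj_rel u' u" and v2: "proj_rel v' v"
    by (rule part_equivp_symp[OF part_equivp_proj_rel u], rule part_equivp_symp[OF part_equivp_proj_rel v])
  let ?x = "\<lambda>u::complex \<times> complex. Const (snd u) * Var X0 - Const (fst u) * Var X1"
  let ?y = "\<lambda>u::complex \<times> complex. Const (snd u) * Var Y0 - Const (fst u) * Var Y1"
  have "ideal_gen ({?x u} \<union> {?y v}) = ideal_gen ({?x u'} \<union> {?y v})"
    by (intro subset_antisym span_subset_of_unit_multiple u u2)
  also have "\<dots> = ideal_gen ({?y v} \<union> {?x u'})"
    by (simp only: Un_commute)
  also have "\<dots> = ideal_gen ({?y v'} \<union> {?x u'})"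
    by (intro subset_antisym span_subset_of_unit_multiple v v2)
  finally show "ideal_gen {?x u, ?y v} = ideal_gen {?x u', ?y v'}"
    by (simp add: insert_commute)
qed

definition point_ideal :: "point \<Rightarrow> coord_ring set" where
  "point_ideal P = point_ideal_aux (fst P) (snd P)"

text \<open>The defining formula for \<open>P = ([a : b], [c : d])\<close>.\<close>

lemma point_ideal_hcoords:
  assumes "(a, b) \<noteq> (0, 0)" "(c, d) \<noteq> (0, 0)"
  shows "point_ideal (hcoords a b, hcoords c d) =
    ideal_gen {Const b * Var X0 - Const a * Var X1, Const d * Var Y0 - Const c * Var Y1}"
proof -
  have "proj_rel (a, b) (a, b)" "proj_rel (c, d) (c, d)"
    using assms by (auto intro!: proj_rel_refl)
  then show ?thesis
    unfolding point_ideal_def hcoords_def by (simp only: fst_conv snd_conv point_ideal_aux.abs_eq)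
qed

section \<open>Ideals of finite point sets and the invariant \<open>\<alpha>\<^sup>*\<close>\<close>

definition radical_ideal :: "point set \<Rightarrow> coord_ring set" where
  "radical_ideal Z = (\<Inter>P \<in> Z. point_ideal P)"

definition symbolic_power :: "point set \<Rightarrow> nat \<Rightarrow> coord_ring set" where
  "symbolic_power Z m = (\<Inter>P \<in> Z. ideal_power (point_ideal P) m)"

definition alpha_star :: "coord_ring set \<Rightarrow> nat" where
  "alpha_star J = (LEAST k. \<exists>F \<in> J. F \<noteq> 0 \<and> form_of_bidegree k k F)"

text \<open>A divisor of bi-degree \<open>(k, l)\<close> is the zero scheme of a non-zero form \<open>F\<close> of that
  bi-degree; vanishing of a form at a point does not depend on the homogeneous coordinates.\<close>

definition vanishes_at :: "coord_ring \<Rightarrow> point \<Rightarrow> bool" where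
  "vanishes_at F P \<longleftrightarrow>
     (\<forall>a b c d. (a, b) \<noteq> (0, 0) \<and> (c, d) \<noteq> (0, 0) \<and> P = (hcoords a b, hcoords c d)
        \<longrightarrow> eval F (a, b) (c, d) = 0)"

definition contained_in_divisor :: "point set \<Rightarrow> nat \<Rightarrow> nat \<Rightarrow> bool" where
  "contained_in_divisor Z k l \<longleftrightarrow>
     (\<exists>F. F \<noteq> 0 \<and> form_of_bidegree k l F \<and> (\<forall>P \<in> Z. vanishes_at F P))"

end

theory Submission
  imports Defs "HOL-Computational_Algebra.Computational_Algebra" "HOL-Computational_Algebra.Field_as_Ring"
begin

text \<open>Write \<open>a = \<alpha>\<^sup>*(I)\<close>. As no form of bidegree \<open>(a - 1, a - 1)\<close> vanishes on \<open>Z\<close>, some \<open>a\<^sup>2\<close> points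
  \<open>W\<close> of \<open>Z\<close> impose independent conditions on these forms, and then \<open>W\<close> lies on curves of bidegree
  \<open>(a, a)\<close> that have no component in common with a given curve. Intersecting with a curve of bidegree
  \<open>(a + 5, a + 5)\<close> that has multiplicity 6 on \<open>W\<close> gives \<open>6 a\<^sup>2 \<le> 2 a (a + 5)\<close>, hence \<open>a \<le> 2\<close>. For \<open>a = 2\<close>
  the four points of \<open>W\<close> lie on no curve of bidegree \<open>(1, 1)\<close>. If their abscissae (or ordinates) are
  distinct, a curve of bidegree \<open>(7, 7)\<close> with multiplicity 6 on \<open>W\<close> contains every graph of bidegree
  \<open>(2, 1)\<close> through \<open>W\<close>, which is absurd; otherwise it can be reduced to nothing by splitting off lines,
  unless \<open>Z\<close> is contained in a grid of two by two points. In that case \<open>\<alpha>\<^sup>*(I\<^sup>(\<^sup>2\<^sup>)) = 2\<close>, against the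
  assumption.\<close>

section \<open>Polynomials in two affine coordinates\<close>

text \<open>Every curve that is not written down explicitly, and Bezout's inequality itself, comes
  from one source: a homogeneous linear system with more unknowns than equations has a nonzero
  solution. To have coordinates for the counts, \<open>Z\<close> is placed in an affine chart; there
  a form of bidegree \<open>(k, k)\<close> becomes a polynomial of degree at most \<open>k\<close>
  in each variable, and membership in the \<open>m\<close>-th power of a point ideal forces the
  Taylor coefficients of order below \<open>m\<close> to vanish. The second curve for Bezout must
  share no component with \<open>D\<close>. It is a member of a pencil \<open>E1 + c E2\<close>,
  where \<open>E1\<close> is constantly 1 on a vertical line that is generic for \<open>D\<close>,
  and \<open>E2\<close> on a horizontal line: no prime factor of \<open>D\<close> divides both. Why
  six: for multiplicity \<open>m\<close> and bidegree \<open>(a + m - 1, a + m - 1)\<close> the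
  inequality \<open>m a <= 2 (a + m - 1)\<close> gives \<open>a <= 2\<close> already for
  \<open>m = 5\<close>. But the four points of \<open>witness\<close> carry curves of bidegree
  \<open>(m + 1, m + 1)\<close> and multiplicity \<open>m\<close> for \<open>1 <= m <= 5\<close>,
  and lose them at \<open>m = 6\<close>.\<close>

text \<open>The inner variable is \<open>x\<close>, the outer one \<open>y\<close>.\<close>

type_synonym 'a bpoly = "'a poly poly"

definition cf :: "'a::zero bpoly \<Rightarrow> nat \<Rightarrow> nat \<Rightarrow> 'a" where
  "cf p i j = coeff (coeff p j) i"

definition ev :: "'a::comm_semiring_0 bpoly \<Rightarrow> 'a \<Rightarrow> 'a \<Rightarrow> 'a" where
  "ev p x y = poly (poly p [:y:]) x"

lemma cf_eqI: "(\<And>i j. cf p i j = cf q i j) \<Longrightarrow> p = q"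
  by (simp add: cf_def poly_eq_iff)

lemma cf_add [simp]: "cf (p + q) i j = cf p i j + cf q i j"
  by (simp add: cf_def)

lemma cf_0 [simp]: "cf 0 i j = 0"
  by (simp add: cf_def)

lemma cf_sum: "cf (sum f A) i j = (\<Sum>a\<in>A. cf (f a) i j)"
  by (simp add: cf_def coeff_sum)

lemma cf_monom: "cf (monom (monom c k) l) i j = (if i = k \<and> j = l then c else 0)"
  by (simp add: cf_def)

lemma cf_smult: "cf (smult [:c:] p) i j = c * cf p i j" for c :: "'a::comm_semiring_0"
  by (simp add: cf_def)

lemma cf_mult: "cf (p * q) i j = (\<Sum>l\<le>j. \<Sum>k\<le>i. cf p k l * cf q (i - k) (j - l))"
  by (simp add: cf_def coeff_mult coeff_sum)

lemma ev_add [simp]: "ev (p + q) x y = ev p x y + ev q x y"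
  by (simp add: ev_def)

lemma ev_mult [simp]: "ev (p * q) x y = ev p x y * ev q x y"
  by (simp add: ev_def)

lemma ev_0 [simp]: "ev 0 x y = 0"
  by (simp add: ev_def)

lemma ev_1 [simp]: "ev 1 x y = 1" for x :: "'a::comm_semiring_1"
  by (simp add: ev_def)

lemma ev_power [simp]: "ev (p ^ n) x y = ev p x y ^ n" for x :: "'a::comm_semiring_1"
  by (induction n) simp_all

lemma ev_sum: "ev (sum f A) x y = (\<Sum>a\<in>A. ev (f a) x y)"
  by (simp add: ev_def poly_sum)

lemma ev_prod: "ev (prod f A) x y = (\<Prod>a\<in>A. ev (f a) x y)" for x :: "'a::comm_semiring_1"
  by (simp add: ev_def poly_prod)

text \<open>Identities between bivariate polynomials are checked below by comparing values. The
  reason: a polynomial in \<open>y\<close> over the domain of polynomials in \<open>x\<close> that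
  has all constants \<open>[:y:]\<close> as roots has infinitely many roots, so it is zero.\<close>

lemma ev_eqI:
  fixes p q :: "'a::{idom, ring_char_0} bpoly"
  assumes "\<And>x y. ev p x y = ev q x y"
  shows "p = q"
proof -
  have "poly (p - q) [:y:] = 0" for y
  proof -
    have "poly (poly (p - q) [:y:]) = poly 0"
      using assms by (auto simp: ev_def fun_eq_iff)
    then show ?thesis
      by (simp only: poly_eq_poly_eq_iff)
  qed
  then have "(\<lambda>y. [:y:]) ` UNIV \<subseteq> {z. poly (p - q) z = 0}"
    by blast
  moreover have "infinite ((\<lambda>y::'a. [:y:]) ` UNIV)"
    using infinite_UNIV_char_0 by (subst finite_image_iff) (auto simp: inj_on_def)
  ultimately have "infinite {z. poly (p - q) z = 0}"
    using finite_subset by blast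
  then have "p - q = 0"
    using poly_roots_finite by blast
  then show ?thesis
    by simp
qed

text \<open>The nested representation treats \<open>x\<close> and \<open>y\<close> differently.
  Exchanging them carries every fact about horizontal lines over to vertical ones, and lets the
  degree in \<open>x\<close> be read off as an outer degree.\<close>

definition swp :: "'a::comm_semiring_1 bpoly \<Rightarrow> 'a bpoly" where
  "swp p = (\<Sum>j\<le>degree p. smult (monom 1 j) (map_poly (\<lambda>c. [:c:]) (coeff p j)))"

lemma cf_swp [simp]: "cf (swp p) i j = cf p j i"
proof -
  have "cf (swp p) i j = (\<Sum>k\<le>degree p. if k = i then coeff (coeff p i) j else 0)"
    unfolding swp_def cf_sum
    by (intro sum.cong refl) (auto simp: cf_def coeff_map_poly)
  also have "\<dots> = cf p j i"
    by (auto simp: cf_def coeff_eq_0)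
  finally show ?thesis .
qed

lemma poly_map_poly_const:
  "poly (map_poly (\<lambda>c. [:c:]) q) [:y:] = [:poly q (y::'a::comm_semiring_1):]"
  by (induction q) (simp_all add: map_poly_pCons mult.commute)

lemma ev_swp [simp]: "ev (swp p) x y = ev p y x"
proof -
  have "ev p y x = (\<Sum>j\<le>degree p. poly (coeff p j) y * x ^ j)"
    by (simp add: ev_def poly_altdef[of p] poly_sum)
  also have "\<dots> = ev (swp p) x y"
    unfolding swp_def ev_sum
    by (intro sum.cong refl) (simp add: ev_def poly_map_poly_const poly_monom mult.commute)
  finally show ?thesis ..
qed

lemma swp_swp [simp]: "swp (swp p) = p"
  by (rule cf_eqI) simp

lemma swp_0 [simp]: "swp 0 = 0"
  by (rule cf_eqI) simp

lemma swp_eq_0_iff [simp]: "swp p = 0 \<longleftrightarrow> p = 0"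
  by (metis swp_0 swp_swp)

lemma swp_mult [simp]: "swp (p * q) = swp p * swp q" for p :: "'a::{idom, ring_char_0} bpoly"
  by (rule ev_eqI) simp

section \<open>Bidegree, and polynomials given by a box of coefficients\<close>

definition bideg :: "'a::comm_semiring_1 bpoly \<Rightarrow> nat \<Rightarrow> nat \<Rightarrow> bool" where
  "bideg p d e \<longleftrightarrow> degree (swp p) \<le> d \<and> degree p \<le> e"

lemma degree_le_cf: "degree p \<le> e \<longleftrightarrow> (\<forall>i j. cf p i j \<noteq> 0 \<longrightarrow> j \<le> e)"
proof
  assume "degree p \<le> e"
  then show "\<forall>i j. cf p i j \<noteq> 0 \<longrightarrow> j \<le> e"
    by (metis cf_def coeff_0 le_degree le_trans)
next
  assume "\<forall>i j. cf p i j \<noteq> 0 \<longrightarrow> j \<le> e"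
  then have "coeff p j = 0" if "j > e" for j
    using that by (auto simp: cf_def poly_eq_iff not_le[symmetric])
  then show "degree p \<le> e"
    by (intro degree_le) auto
qed

lemma bideg_cf: "bideg p d e \<longleftrightarrow> (\<forall>i j. cf p i j \<noteq> 0 \<longrightarrow> i \<le> d \<and> j \<le> e)"
  unfolding bideg_def degree_le_cf cf_swp by blast

lemma bideg_swp [simp]: "bideg (swp p) d e \<longleftrightarrow> bideg p e d"
  by (auto simp: bideg_def)

lemma bideg_mono: "bideg p d e \<Longrightarrow> d \<le> d' \<Longrightarrow> e \<le> e' \<Longrightarrow> bideg p d' e'"
  by (auto simp: bideg_def)

lemma bideg_0 [simp]: "bideg 0 d e"
  by (simp add: bideg_def)

lemma bideg_add: "bideg p d e \<Longrightarrow> bideg q d e \<Longrightarrow> bideg (p + q) d e"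
  unfolding bideg_cf by (metis add.right_neutral cf_add)

lemma bideg_sum: "(\<And>a. a \<in> A \<Longrightarrow> bideg (f a) d e) \<Longrightarrow> bideg (sum f A) d e"
  by (induction A rule: infinite_finite_induct) (auto intro: bideg_add)

lemma bideg_mult: "bideg p d e \<Longrightarrow> bideg q d' e' \<Longrightarrow> bideg (p * q) (d + d') (e + e')"
  for p :: "'a::{idom, ring_char_0} bpoly"
  unfolding bideg_def swp_mult by (meson add_mono degree_mult_le le_trans)

text \<open>Linear parametrization of the polynomials of bidegree at most \<open>(d, e)\<close>: the
  family \<open>c\<close> is the vector of unknowns in the linear systems below.\<close>

definition box_poly :: "nat \<Rightarrow> nat \<Rightarrow> (nat \<times> nat \<Rightarrow> 'a) \<Rightarrow> 'a::comm_semiring_1 bpoly" where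
  "box_poly d e c = (\<Sum>(i, j)\<in>{..d} \<times> {..e}. monom (monom (c (i, j)) i) j)"

lemma cf_box_poly: "cf (box_poly d e c) i j = (if i \<le> d \<and> j \<le> e then c (i, j) else 0)"
proof -
  have "cf (box_poly d e c) i j = (\<Sum>k\<in>{..d} \<times> {..e}. if k = (i, j) then c (i, j) else 0)"
    unfolding box_poly_def cf_sum
    by (intro sum.cong refl) (auto simp: cf_monom split: prod.splits if_splits)
  then show ?thesis
    by (simp add: sum.delta)
qed

lemma box_poly_nonzero:
  assumes "\<forall>i. i \<notin> {..d} \<times> {..e} \<longrightarrow> c i = 0" "\<exists>i. c i \<noteq> 0"
  shows "box_poly d e c \<noteq> 0"
proof
  assume "box_poly d e c = 0"
  then have "cf (box_poly d e c) i j = 0" for i j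
    by simp
  then have "c (i, j) = 0" for i j
    using assms(1) unfolding cf_box_poly by (metis SigmaE2 atMost_iff mem_Sigma_iff)
  then show False
    using assms(2) by auto
qed

lemma bideg_box_poly: "bideg (box_poly d e c) d e"
  by (auto simp: bideg_cf cf_box_poly)

lemma box_poly_add: "box_poly d e (\<lambda>i. c i + c' i) = box_poly d e c + box_poly d e c'"
  by (rule cf_eqI) (simp add: cf_box_poly)

lemma box_poly_smult: "box_poly d e (\<lambda>i. s * c i) = smult [:s:] (box_poly d e c)"
  by (rule cf_eqI) (simp add: cf_box_poly cf_smult)

section \<open>Order of vanishing\<close>

text \<open>Translation moving \<open>P\<close> to the origin, so that its coefficients are the
  Taylor coefficients at \<open>P\<close>. As \<open>pcompose\<close> substitutes only for the outer
  variable, the second substitution takes place between two swaps.\<close>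

definition shift :: "'a \<times> 'a \<Rightarrow> 'a::comm_ring_1 bpoly \<Rightarrow> 'a bpoly" where
  "shift P p = swp (pcompose (swp (pcompose p [:[:snd P:], 1:])) [:[:fst P:], 1:])"

lemma ev_pcompose: "ev (pcompose p [:[:b:], 1:]) x y = ev p x (y + b)"
  for b :: "'a::comm_ring_1"
  by (simp add: ev_def poly_pcompose add.commute)

lemma ev_shift [simp]: "ev (shift P p) x y = ev p (x + fst P) (y + snd P)"
  by (simp add: shift_def ev_pcompose)

definition vanish :: "nat \<Rightarrow> 'a \<times> 'a \<Rightarrow> 'a::comm_ring_1 bpoly \<Rightarrow> bool" where
  "vanish m P p \<longleftrightarrow> (\<forall>i j. i + j < m \<longrightarrow> cf (shift P p) i j = 0)"

definition vline :: "'a \<Rightarrow> 'a::comm_ring_1 bpoly" where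
  "vline c = [:[:- c, 1:]:]"

definition hline :: "'a \<Rightarrow> 'a::comm_ring_1 bpoly" where
  "hline c = [:[:- c:], 1:]"

lemma ev_vline [simp]: "ev (vline c) x y = x - c"
  by (simp add: ev_def vline_def)

lemma ev_hline [simp]: "ev (hline c) x y = y - c"
  by (simp add: ev_def hline_def)

lemma cf_0_0: "cf p 0 0 = ev p 0 0"
  by (simp add: cf_def ev_def poly_0_coeff_0)

context
  fixes p q :: "'a::{idom, ring_char_0} bpoly"
begin

lemma shift_mult [simp]: "shift P (p * q) = shift P p * shift P q"
  by (rule ev_eqI) simp

lemma shift_add [simp]: "shift P (p + q) = shift P p + shift P q"
  by (rule ev_eqI) simp

lemma shift_smult [simp]: "shift P (smult [:c:] p) = smult [:c:] (shift P p)"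
proof (rule ev_eqI)
  have *: "ev (smult [:c:] r) x y = c * ev r x y" for r :: "'a bpoly" and x y
    by (simp add: ev_def)
  show "ev (shift P (smult [:c:] p)) x y = ev (smult [:c:] (shift P p)) x y" for x y
    by (simp add: *)
qed

lemma shift_swp: "shift (b, a) (swp p) = swp (shift (a, b) p)"
  by (rule ev_eqI) simp

lemma swp_add [simp]: "swp (p + q) = swp p + swp q"
  by (rule ev_eqI) simp

end

lemma shift_vline: "shift P (vline c) = [:[:fst P - c, 1:]:]" for c :: "'a::{idom, ring_char_0}"
  by (rule ev_eqI) (simp, simp add: ev_def)

lemma swp_vline [simp]: "swp (vline c) = hline c" for c :: "'a::{idom, ring_char_0}"
  by (rule ev_eqI) simp

lemma swp_hline [simp]: "swp (hline c) = vline c" for c :: "'a::{idom, ring_char_0}"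
  by (rule ev_eqI) simp

lemma vline_nonzero [simp]: "vline c \<noteq> 0"
  by (simp add: vline_def)

lemma hline_nonzero [simp]: "hline c \<noteq> 0"
  by (simp add: hline_def)

lemma bideg_vline: "bideg (vline c) 1 0" for c :: "'a::{idom, ring_char_0}"
  unfolding bideg_def swp_vline by (simp add: vline_def hline_def)

lemma bideg_hline: "bideg (hline c) 0 1" for c :: "'a::{idom, ring_char_0}"
  unfolding bideg_def swp_hline by (simp add: vline_def hline_def)

lemma shift_0 [simp]: "shift P 0 = 0"
  by (simp add: shift_def)

lemma vanish_0 [simp]: "vanish m P 0"
  by (simp add: vanish_def)

lemma vanish_zero [simp]: "vanish 0 P p"
  by (simp add: vanish_def)

context
  fixes p q :: "'a::{idom, ring_char_0} bpoly"
begin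

lemma vanish_1_iff: "vanish (Suc 0) P p \<longleftrightarrow> ev p (fst P) (snd P) = 0"
  by (simp add: vanish_def cf_0_0)

lemma vanish_swp: "vanish m (a, b) (swp p) \<longleftrightarrow> vanish m (b, a) p"
  unfolding vanish_def shift_swp cf_swp by (metis add.commute)

lemma vanish_add: "vanish m P p \<Longrightarrow> vanish m P q \<Longrightarrow> vanish m P (p + q)"
  by (simp add: vanish_def)

lemma vanish_smult: "vanish m P p \<Longrightarrow> vanish m P (smult [:c:] p)"
  by (simp add: vanish_def cf_smult)

lemma vanish_mult:
  assumes "vanish m P p" "vanish n P q"
  shows "vanish (m + n) P (p * q)"
  unfolding vanish_def
proof (intro allI impI)
  fix i j assume ij: "i + j < m + n"
  have "cf (shift P p) k l * cf (shift P q) (i - k) (j - l) = 0" if "k \<le> i" "l \<le> j" for k l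
  proof (cases "k + l < m")
    case False
    then have "(i - k) + (j - l) < n"
      using ij that by linarith
    then show ?thesis
      using assms by (simp add: vanish_def)
  qed (use assms in \<open>simp add: vanish_def\<close>)
  then show "cf (shift P (p * q)) i j = 0"
    unfolding shift_mult cf_mult by (intro sum.neutral ballI) auto
qed

lemma vanish_mult_left: "vanish m P p \<Longrightarrow> vanish m P (q * p)"
  using vanish_mult by (metis add_0 vanish_mult vanish_zero mult.commute add.right_neutral)

text \<open>A polynomial that is nonzero at \<open>P\<close> is a unit in the local ring there.
  Concretely, by induction on \<open>i + j\<close>: in the convolution for the coefficient
  \<open>(i, j)\<close> of the product, only the term \<open>cf (shift P p) i j\<close> times the
  value of \<open>q\<close> at \<open>P\<close> survives.\<close>

lemma vanish_cancel:
  assumes u: "ev q (fst P) (snd P) \<noteq> 0" and v: "vanish m P (q * p)"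
  shows "vanish m P p"
  unfolding vanish_def
proof (intro allI impI)
  fix i j assume "i + j < m"
  then show "cf (shift P p) i j = 0"
  proof (induction "i + j" arbitrary: i j rule: less_induct)
    case less
    have "0 = cf (shift P p * shift P q) i j"
      using v less.prems by (simp add: vanish_def mult.commute)
    also have "\<dots> = (\<Sum>l\<le>j. \<Sum>k\<le>i. if l = j then if k = i then cf (shift P p) i j * cf (shift P q) 0 0 else 0 else 0)"
      unfolding cf_mult
    proof (intro sum.cong refl)
      fix l k assume lk: "l \<in> {..j}" "k \<in> {..i}"
      show "cf (shift P p) k l * cf (shift P q) (i - k) (j - l)
        = (if l = j then if k = i then cf (shift P p) i j * cf (shift P q) 0 0 else 0 else 0)"
      proof (cases "l = j \<and> k = i")
        case False
        then have "k + l < i + j"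
          using lk by auto
        then have "cf (shift P p) k l = 0"
          using less by (meson less_trans)
        then show ?thesis
          using False by auto
      qed auto
    qed
    also have "\<dots> = (\<Sum>l\<le>j. if l = j then cf (shift P p) i j * cf (shift P q) 0 0 else 0)"
      by (intro sum.cong refl) auto
    also have "\<dots> = cf (shift P p) i j * cf (shift P q) 0 0"
      by simp
    finally show ?case
      using u by (simp add: cf_0_0)
  qed
qed

text \<open>After the translation the line is the variable \<open>x\<close> itself, so multiplying
  by it just raises the inner exponent by one.\<close>

lemma vanish_vline_cancel:
  assumes "vanish m P (vline (fst P) * p)"
  shows "vanish (m - 1) P p"
  unfolding vanish_def
proof (intro allI impI)
  fix i j assume "i + j < m - 1"
  then have "cf (shift P (vline (fst P) * p)) (Suc i) j = 0"
    using assms by (simp add: vanish_def)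
  then show "cf (shift P p) i j = 0"
    unfolding shift_mult shift_vline by (simp add: cf_def)
qed

end

section \<open>Linear systems with more unknowns than equations\<close>

text \<open>Induction on the equations. If a solution \<open>c\<close> of the old equations violates
  the new one, take \<open>i1\<close> with \<open>c i1\<close> nonzero and a second solution
  \<open>c'\<close> supported off \<open>i1\<close>. A combination \<open>c' + s c\<close> solves
  the new equation, and it is not zero because its entry at \<open>i1\<close> is
  \<open>s * c i1\<close>, or else \<open>s = 0\<close> and it equals \<open>c'\<close>.\<close>

lemma homogeneous_system_solution:
  fixes f :: "'k \<Rightarrow> ('i \<Rightarrow> 'a::field) \<Rightarrow> 'a"
  assumes "finite I" "finite K" "card K < card I"
    and add: "\<And>k x y. k \<in> K \<Longrightarrow> f k (\<lambda>i. x i + y i) = f k x + f k y"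
    and scale: "\<And>k s x. k \<in> K \<Longrightarrow> f k (\<lambda>i. s * x i) = s * f k x"
  shows "\<exists>c. (\<forall>i. i \<notin> I \<longrightarrow> c i = 0) \<and> (\<exists>i. c i \<noteq> 0) \<and> (\<forall>k\<in>K. f k c = 0)"
  using assms(2,1,3) add scale
proof (induction K arbitrary: I rule: finite_induct)
  case empty
  then obtain i where "i \<in> I"
    by fastforce
  then show ?case
    by (intro exI[of _ "\<lambda>j. if j = i then 1 else 0"]) auto
next
  case (insert k K)
  have IH: "\<exists>c. (\<forall>j. j \<notin> I - {i} \<longrightarrow> c j = 0) \<and> (\<exists>j. c j \<noteq> 0) \<and> (\<forall>k\<in>K. f k c = 0)" for i
  proof (rule insert.IH)
    show "finite (I - {i})" "card K < card (I - {i})"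
      using insert.prems(1,2) insert.hyps by (auto simp: card_Diff_singleton_if)
  qed (use insert.prems(3,4) in auto)
  obtain i0 where "i0 \<in> I"
    using insert.prems by fastforce
  obtain c where c: "\<forall>j. j \<notin> I \<longrightarrow> c j = 0" "\<exists>j. c j \<noteq> 0" "\<forall>k\<in>K. f k c = 0"
    using IH[of i0] by blast
  show ?case
  proof (cases "f k c = 0")
    case False
    obtain i1 where i1: "c i1 \<noteq> 0"
      using c by blast
    obtain c' where c': "\<forall>j. j \<notin> I - {i1} \<longrightarrow> c' j = 0" "\<exists>j. c' j \<noteq> 0" "\<forall>k\<in>K. f k c' = 0"
      using IH[of i1] by blast
    define s where "s = - (f k c' / f k c)"
    define e where "e = (\<lambda>i. c' i + s * c i)"
    have f: "f l e = f l c' + s * f l c" if "l \<in> insert k K" for l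
      unfolding e_def using insert.prems(3,4)[OF that] by simp
    have "\<exists>i. e i \<noteq> 0"
    proof (cases "s = 0")
      case True
      then show ?thesis
        using c'(2) by (simp add: e_def)
    next
      case False
      then have "e i1 \<noteq> 0"
        using i1 c'(1) by (simp add: e_def)
      then show ?thesis ..
    qed
    moreover have "\<forall>i. i \<notin> I \<longrightarrow> e i = 0"
      using c c' by (simp add: e_def)
    moreover have "\<forall>l\<in>insert k K. f l e = 0"
      using f c(3) c'(3) False by (auto simp: s_def)
    ultimately show ?thesis
      by blast
  qed (use c in blast)
qed

section \<open>Lines\<close>

lemma poly_hline: "poly (poly p [:c:]) x = ev p x c"
  by (simp add: ev_def)

lemma poly_vline: "poly (poly (swp p) [:c:]) y = ev p c y"
  by (simp add: poly_hline)

lemma hline_dvd: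
  fixes p :: "'a::idom bpoly"
  assumes "poly p [:c:] = 0"
  obtains q where "p = hline c * q"
proof -
  have "[:- [:c:], 1:] dvd p"
    using assms by (simp add: poly_eq_0_iff_dvd)
  then show ?thesis
    using that by (auto simp: hline_def elim: dvdE)
qed

lemma vline_dvd:
  fixes p :: "'a::{idom, ring_char_0} bpoly"
  assumes "poly (swp p) [:c:] = 0"
  obtains q where "p = vline c * q"
  by (metis assms hline_dvd swp_hline swp_mult swp_swp)

lemma bideg_hline_mult:
  fixes q :: "'a::{idom, ring_char_0} bpoly"
  assumes "bideg (hline c * q) d e" "q \<noteq> 0"
  shows "0 < e" "bideg q d (e - 1)"
proof -
  have "degree (hline c * q) = degree q + 1"
    using assms by (subst degree_mult_eq) (simp_all, simp add: hline_def)
  moreover have "degree (swp (hline c * q)) = degree (swp q)"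
    using assms unfolding swp_mult by (subst degree_mult_eq) (simp_all, simp add: vline_def)
  ultimately show "0 < e" "bideg q d (e - 1)"
    using assms by (auto simp: bideg_def)
qed

lemma bideg_vline_mult:
  fixes q :: "'a::{idom, ring_char_0} bpoly"
  assumes "bideg (vline c * q) d e" "q \<noteq> 0"
  shows "0 < d" "bideg q (d - 1) e"
  using bideg_hline_mult[of c "swp q" e d] assms
  by (metis bideg_swp swp_eq_0_iff swp_mult swp_vline)+

lemma degree_poly_hline: "bideg p d e \<Longrightarrow> degree (poly p [:c:]) \<le> d"
  for p :: "'a::comm_ring_1 bpoly"
proof (rule degree_le, intro allI impI)
  fix i assume "bideg p d e" "d < i"
  then have "coeff (coeff p j) i = 0" for j
    unfolding bideg_cf cf_def by (metis not_le)
  moreover have "coeff (coeff p j * [:c:] ^ j) i = coeff (coeff p j) i * c ^ j" for j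
  proof -
    have "[:c:] ^ j = [:c ^ j:]"
      by (induction j) (simp_all add: mult.commute)
    then show ?thesis
      by simp
  qed
  ultimately show "coeff (poly p [:c:]) i = 0"
    by (simp add: poly_altdef[of p] coeff_sum)
qed

lemma degree_poly_vline: "bideg p d e \<Longrightarrow> degree (poly (swp p) [:c:]) \<le> e"
  for p :: "'a::comm_ring_1 bpoly"
  using degree_poly_hline[of "swp p" e d] by simp

lemma bideg_smult: "bideg p d e \<Longrightarrow> bideg (smult [:c:] p) d e"
  unfolding bideg_cf cf_smult by (metis mult_zero_right)

lemma ev_smult [simp]: "ev (smult [:c:] p) x y = c * ev p x y"
  for c :: "'a::comm_semiring_1"
  by (simp add: ev_def)

section \<open>Bezout's inequality\<close>

lemma bideg_power: "bideg p d e \<Longrightarrow> bideg (p ^ n) (n * d) (n * e)"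
  for p :: "'a::{idom, ring_char_0} bpoly"
proof (induction n)
  case 0
  have "swp 1 = (1::'a bpoly)"
    by (rule ev_eqI) simp
  then show ?case
    by (simp add: bideg_def)
next
  case (Suc n)
  then show ?case
    using bideg_mult[of p d e "p ^ n" "n * d" "n * e"] by simp
qed

lemma bideg_prod:
  fixes f :: "'b \<Rightarrow> 'a::{idom, ring_char_0} bpoly"
  assumes "\<And>a. a \<in> A \<Longrightarrow> bideg (f a) d e"
  shows "bideg (prod f A) (card A * d) (card A * e)"
  using assms
proof (induction A rule: infinite_finite_induct)
  case (insert a A)
  then show ?case
    using bideg_mult[of "f a" d e "prod f A" "card A * d" "card A * e"] by simp
qed (use bideg_power[of _ 0 0 0] in \<open>simp_all add: bideg_power[of 0 _ _ 0, simplified]\<close>)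

section \<open>Jets of prescribed order at a point, and polynomials separating a point from the
  others\<close>

definition triangle :: "nat \<Rightarrow> (nat \<times> nat) set" where
  "triangle m = {(i, j). i + j < m}"

lemma finite_triangle [simp]: "finite (triangle m)"
  by (rule finite_subset[of _ "{..m} \<times> {..m}"]) (auto simp: triangle_def)

lemma card_triangle_Suc: "card (triangle (Suc n)) = card (triangle n) + Suc n"
proof -
  have "triangle (Suc n) = triangle n \<union> (\<lambda>i. (i, n - i)) ` {..n}"
    by (auto simp: triangle_def image_iff)
  moreover have "triangle n \<inter> (\<lambda>i. (i, n - i)) ` {..n} = {}"
    by (auto simp: triangle_def)
  moreover have "card ((\<lambda>i. (i, n - i)) ` {..n}) = Suc n"
    by (subst card_image) (auto simp: inj_on_def)
  ultimately show ?thesis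
    by (simp add: card_Un_disjoint)
qed

lemma shift_lines_power:
  fixes P :: "'a::{idom, ring_char_0} \<times> 'a"
  shows "shift P (vline (fst P) ^ i * hline (snd P) ^ j) = monom (monom 1 i) j"
  by (rule ev_eqI) (simp, simp add: ev_def poly_monom)

lemma shift_sum: "shift P (sum f A) = (\<Sum>a\<in>A. shift P (f a))"
  for f :: "'b \<Rightarrow> 'a::{idom, ring_char_0} bpoly"
  by (induction A rule: infinite_finite_induct) simp_all

lemma vanish_sum: "(\<And>a. a \<in> A \<Longrightarrow> vanish m P (f a)) \<Longrightarrow> vanish m P (sum f A)"
  for f :: "'b \<Rightarrow> 'a::{idom, ring_char_0} bpoly"
  by (induction A rule: infinite_finite_induct) (auto intro: vanish_add)

lemma vanish_power: "vanish k P p \<Longrightarrow> vanish (m * k) P (p ^ m)"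
  for p :: "'a::{idom, ring_char_0} bpoly"
  by (induction m) (auto intro: vanish_mult)

lemma vanish_uminus: "vanish m P p \<Longrightarrow> vanish m P (- p)"
  for p :: "'a::{idom, ring_char_0} bpoly"
proof -
  have "ev (- q) x y = - ev q x y" for q :: "'a bpoly" and x y
    by (simp add: ev_def)
  then have "shift P (- p) = - shift P p"
    by (intro ev_eqI) simp
  then show "vanish m P p \<Longrightarrow> vanish m P (- p)"
    by (simp add: vanish_def cf_def)
qed

definition jet_poly :: "nat \<Rightarrow> 'a \<times> 'a \<Rightarrow> (nat \<times> nat \<Rightarrow> 'a) \<Rightarrow> 'a::comm_ring_1 bpoly" where
  "jet_poly m P c =
     (\<Sum>(i, j)\<in>triangle m. smult [:c (i, j):] (vline (fst P) ^ i * hline (snd P) ^ j))"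

context
  fixes P :: "'a::{idom, ring_char_0} \<times> 'a" and m :: nat
begin

lemma jet_poly_add: "jet_poly m P (\<lambda>i. c i + c' i) = jet_poly m P c + jet_poly m P c'"
  unfolding jet_poly_def
  by (rule ev_eqI) (simp add: ev_sum split_def distrib_right flip: sum.distrib)

lemma jet_poly_smult: "jet_poly m P (\<lambda>i. s * c i) = smult [:s:] (jet_poly m P c)"
  unfolding jet_poly_def by (rule ev_eqI) (simp add: ev_sum sum_distrib_left split_def mult.assoc)

lemma cf_shift_jet_poly:
  assumes "(i, j) \<in> triangle m"
  shows "cf (shift P (jet_poly m P c)) i j = c (i, j)"
proof -
  have "cf (shift P (jet_poly m P c)) i j = (\<Sum>k\<in>triangle m. if k = (i, j) then c (i, j) else 0)"
    unfolding jet_poly_def shift_sum cf_sum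
    by (intro sum.cong refl)
      (auto simp del: shift_mult simp: cf_smult shift_lines_power cf_monom split: prod.splits)
  then show ?thesis
    using assms by simp
qed

lemma bideg_jet_poly: "bideg (jet_poly m P c) m m"
  unfolding jet_poly_def
proof (rule bideg_sum, clarify)
  fix i j assume "(i, j) \<in> triangle m"
  then have ij: "i \<le> m" "j \<le> m"
    by (auto simp: triangle_def)
  have "bideg (vline (fst P) ^ i * hline (snd P) ^ j) (i * 1 + j * 0) (i * 0 + j * 1)"
    by (intro bideg_mult bideg_power bideg_vline bideg_hline)
  then show "bideg (smult [:c (i, j):] (vline (fst P) ^ i * hline (snd P) ^ j)) m m"
    using ij by (intro bideg_smult) (auto elim: bideg_mono)
qed

end

context
  fixes W :: "('a::field_char_0 \<times> 'a) set" and m :: nat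
begin

text \<open>Vanishes to order \<open>m\<close> at the other points of \<open>W\<close> but not at
  \<open>P\<close>: through each \<open>Q\<close> passes a vertical line avoiding \<open>P\<close>
  if the abscissae differ, and otherwise a horizontal one.\<close>

definition separator :: "'a \<times> 'a \<Rightarrow> 'a bpoly" where
  "separator P = (\<Prod>Q\<in>W - {P}. if fst P \<noteq> fst Q then vline (fst Q) else hline (snd Q)) ^ m"

lemma ev_separator: 
  assumes "finite W"
  shows "ev (separator P) (fst P) (snd P) \<noteq> 0"
proof -
  have "ev (if fst P \<noteq> fst Q then vline (fst Q) else hline (snd Q)) (fst P) (snd P) \<noteq> 0"
    if "Q \<in> W - {P}" for Q
    using that by (auto simp: prod_eq_iff)
  then show ?thesis
    using assms unfolding separator_def ev_power ev_prod by (simp del: split_paired_All)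
qed

lemma vanish_separator:
  assumes "finite W" "P \<in> W" "P \<noteq> Q"
  shows "vanish m P (separator Q)"
proof -
  let ?f = "\<lambda>P. if fst Q \<noteq> fst P then vline (fst P) else hline (snd P)"
  have "prod ?f (W - {Q}) = prod ?f (W - {Q} - {P}) * ?f P"
    using assms by (subst prod.remove[of _ P]) (auto simp: mult.commute)
  moreover have "vanish (Suc 0) P (?f P)"
    by (auto simp: vanish_1_iff)
  ultimately have "vanish (Suc 0) P (prod ?f (W - {Q}))"
    by (simp only: vanish_mult_left)
  then have "vanish (m * Suc 0) P (separator Q)"
    unfolding separator_def by (rule vanish_power)
  then show ?thesis
    by simp
qed

lemma bideg_separator: "finite W \<Longrightarrow> bideg (separator P) (m * card W) (m * card W)"
proof -
  assume "finite W"
  then have "card (W - {P}) \<le> card W"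
    by (simp add: card_mono)
  moreover have "bideg (separator P) (m * (card (W - {P}) * 1)) (m * (card (W - {P}) * 1))"
    unfolding separator_def
    by (intro bideg_power bideg_prod) (auto intro: bideg_mono[OF bideg_vline] bideg_mono[OF bideg_hline])
  ultimately show ?thesis
    by (auto elim!: bideg_mono)
qed

end

text \<open>The space of all \<open>A D + B E\<close>, with \<open>B\<close> vanishing to order \<open>n\<close> on \<open>W\<close>, and of prescribed
  \<open>n\<close>-jets at the points of \<open>W\<close> would not fit into the polynomials of bidegree \<open>(N, N)\<close> if the
  inequality failed. The trivial relations \<open>(T E) D + (- T D) E = 0\<close> are excluded by asking that
  \<open>A\<close> has no monomials divisible by the leading monomial of \<open>E\<close>.\<close>

lemma bezout_inequality:
  fixes D E :: "'a::field_char_0 bpoly"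
  assumes W: "finite W" and D: "bideg D d1 d2" and DW: "\<And>P. P \<in> W \<Longrightarrow> vanish (Suc n) P D"
    and E0: "E \<noteq> 0" and EW: "\<And>P. P \<in> W \<Longrightarrow> vanish (Suc 0) P E"
    and coprime: "\<And>A. E dvd A * D \<Longrightarrow> E dvd A"
  shows "Suc n * card W \<le> d1 * degree E + d2 * degree (swp E)"
proof (rule ccontr)
  assume neg: "\<not> Suc n * card W \<le> d1 * degree E + d2 * degree (swp E)"
  define u v w where "u = degree (swp E)" and "v = degree E" and "w = degree (lead_coeff E)"
  \<comment> \<open>Large enough that all truncated differences below are genuine and that the jet
    terms, of bidegree at most \<open>Suc n * (card W + 1)\<close> in each variable, fit into the
    box of size \<open>N\<close>.\<close>
  define N where "N = d1 + d2 + u + v + Suc n * (card W + 1)"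
  \<comment> \<open>The sets \<open>IA\<close>, \<open>IB\<close>, \<open>IT\<close> index the
    unknowns: coefficients of \<open>A\<close> and \<open>B\<close>, and jets of order
    \<open>n\<close> at the points of \<open>W\<close>. The sets \<open>KC\<close>,
    \<open>KA\<close>, \<open>KT\<close> index the equations: \<open>G\<close> is zero,
    \<open>A\<close> has no monomial in the excluded range, and \<open>B\<close> vanishes to order
    \<open>n\<close> on \<open>W\<close>.\<close>
  define IA where "IA = {..N - d1} \<times> {..N - d2}"
  define IB where "IB = {..N - u} \<times> {..N - v}"
  define IT where "IT = W \<times> triangle (Suc n)"
  define KA where "KA = {..N - d1 - u} \<times> {..N - d2 - v}"
  define KC where "KC = {..N} \<times> {..N}"
  define KT where "KT = W \<times> triangle n"
  define A where "A = (\<lambda>c :: (nat \<times> nat) + ((nat \<times> nat) + ('a \<times> 'a) \<times> nat \<times> nat) \<Rightarrow> 'a. box_poly (N - d1) (N - d2) (\<lambda>k. c (Inl k)) :: 'a bpoly)"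
  define B where "B = (\<lambda>c :: (nat \<times> nat) + ((nat \<times> nat) + ('a \<times> 'a) \<times> nat \<times> nat) \<Rightarrow> 'a. box_poly (N - u) (N - v) (\<lambda>k. c (Inr (Inl k))) :: 'a bpoly)"
  define t where "t = (\<lambda>(c :: (nat \<times> nat) + ((nat \<times> nat) + ('a \<times> 'a) \<times> nat \<times> nat) \<Rightarrow> 'a) P. jet_poly (Suc n) P (\<lambda>k. c (Inr (Inr (P, k)))) :: 'a bpoly)"
  define U where "U = separator W (Suc n)"
  define G where "G = (\<lambda>c. A c * D + B c * E + (\<Sum>P\<in>W. t c P * U P))"
  \<comment> \<open>The pair \<open>(w, v)\<close> is the exponent of the leading monomial of
    \<open>E\<close> when the degree in \<open>y\<close> is compared first. The shifted box
    \<open>KA\<close> has exactly as many elements as there are coefficients in a cofactor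
    \<open>T\<close> with \<open>A = E T\<close>.\<close>
  define f where "f = (\<lambda>k c. case k of Inl (i, j) \<Rightarrow> cf (G c) i j
    | Inr (Inl (i, j)) \<Rightarrow> cf (A c) (i + w) (j + v)
    | Inr (Inr (P, (i, j))) \<Rightarrow> cf (shift P (B c)) i j)"
  have A_add: "A (\<lambda>i. x i + y i) = A x + A y" and B_add: "B (\<lambda>i. x i + y i) = B x + B y"
    and t_add: "t (\<lambda>i. x i + y i) P = t x P + t y P" for x y P
    by (simp_all add: A_def B_def t_def box_poly_add jet_poly_add)
  have A_scale: "A (\<lambda>i. s * x i) = smult [:s:] (A x)"
    and B_scale: "B (\<lambda>i. s * x i) = smult [:s:] (B x)"
    and t_scale: "t (\<lambda>i. s * x i) P = smult [:s:] (t x P)" for s x P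
    by (simp_all add: A_def B_def t_def box_poly_smult jet_poly_smult)
  have G_add: "G (\<lambda>i. x i + y i) = G x + G y" for x y
    by (simp add: G_def A_add B_add t_add algebra_simps sum.distrib)
  have G_scale: "G (\<lambda>i. s * x i) = smult [:s:] (G x)" for s x
    by (rule ev_eqI) (simp add: G_def A_scale B_scale t_scale ev_sum sum_distrib_left algebra_simps)
  have sizes: "d1 + u \<le> N" "d2 + v \<le> N" "Suc n + Suc n * card W \<le> N"
    by (simp_all add: N_def)
  \<comment> \<open>Unknowns minus equations is \<open>Suc n * card W - (d1 * v + d2 * u)\<close>.
    The first term arises because a triangle of size \<open>Suc n\<close> exceeds one of size
    \<open>n\<close> by \<open>Suc n\<close>.\<close>
  have "card (KC <+> (KA <+> KT)) < card (IA <+> (IB <+> IT))"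
  proof -
    have "card (KC <+> (KA <+> KT)) =
        (N + 1) * (N + 1) + ((N - d1 - u + 1) * (N - d2 - v + 1) + card W * card (triangle n))"
      using W by (simp add: card_Plus KC_def KA_def KT_def card_cartesian_product)
    moreover have "card (IA <+> (IB <+> IT)) =
        (N - d1 + 1) * (N - d2 + 1) + ((N - u + 1) * (N - v + 1) + card W * (card (triangle n) + Suc n))"
      using W by (simp add: card_Plus IA_def IB_def IT_def card_cartesian_product card_triangle_Suc)
    moreover have "(N - d1 + 1) * (N - d2 + 1) + (N - u + 1) * (N - v + 1) + (d1 * v + d2 * u)
      = (N + 1) * (N + 1) + (N - d1 - u + 1) * (N - d2 - v + 1)"
    proof -
      obtain r s where r: "N = d1 + u + r" and s: "N = d2 + v + s"
        using sizes by (metis le_Suc_ex)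
      have "N - d1 = u + r" "N - u = d1 + r" "N - d1 - u = r" "N - d2 = v + s" "N - v = d2 + s"
        "N - d2 - v = s"
        using r s by linarith+
      moreover have "(N + 1) * (N + 1) = (d1 + u + r + 1) * (d2 + v + s + 1)"
        by (simp only: r[symmetric] s[symmetric])
      ultimately show ?thesis
        by (simp add: algebra_simps)
    qed
    moreover have "d1 * v + d2 * u < Suc n * card W"
      using neg by (simp add: u_def v_def)
    ultimately show ?thesis
      by (simp add: algebra_simps)
  qed
  moreover have "finite (IA <+> (IB <+> IT))" "finite (KC <+> (KA <+> KT))"
    using W by (simp_all add: IA_def IB_def IT_def KC_def KA_def KT_def)
  moreover have "f k (\<lambda>i. x i + y i) = f k x + f k y" for k x y
    by (simp add: f_def G_add A_add B_add split: sum.splits prod.splits)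
  moreover have "f k (\<lambda>i. s * x i) = s * f k x" for k s x
    by (simp add: f_def G_scale A_scale B_scale cf_smult  split: sum.splits prod.splits)
  ultimately obtain c where c: "\<forall>i. i \<notin> IA <+> (IB <+> IT) \<longrightarrow> c i = 0" "\<exists>i. c i \<noteq> 0"
    and fc: "\<forall>k\<in>KC <+> (KA <+> KT). f k c = 0"
    using homogeneous_system_solution[of "IA <+> (IB <+> IT)" "KC <+> (KA <+> KT)" f] by blast
  have bidegA: "bideg (A c) (N - d1) (N - d2)" and bidegB: "bideg (B c) (N - u) (N - v)"
    by (simp_all add: A_def B_def bideg_box_poly)
  have "bideg (G c) N N"
    unfolding G_def
  proof (intro bideg_add bideg_sum)
    show "bideg (A c * D) N N"
      using bideg_mult[OF bidegA D] sizes by simp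
    have "bideg E u v"
      by (simp add: bideg_def u_def v_def)
    then show "bideg (B c * E) N N"
      using bideg_mult[OF bidegB] sizes by fastforce
    show "bideg (t c P * U P) N N" for P
    proof (rule bideg_mono)
      show "bideg (t c P * U P) (Suc n + Suc n * card W) (Suc n + Suc n * card W)"
        unfolding t_def U_def by (rule bideg_mult[OF bideg_jet_poly bideg_separator[OF W]])
    qed (use sizes(3) in simp_all)
  qed
  moreover have "cf (G c) i j = 0" if "i \<le> N" "j \<le> N" for i j
    using fc that by (auto simp: f_def KC_def dest!: bspec[of _ _ "Inl (i, j)"])
  ultimately have G0: "G c = 0"
    by (intro cf_eqI) (metis bideg_cf cf_0)
  have BW: "vanish n P (B c)" if "P \<in> W" for P
    unfolding vanish_def
  proof (intro allI impI)
    fix i j assume "i + j < n"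
    then have "Inr (Inr (P, (i, j))) \<in> KC <+> (KA <+> KT)"
      using that by (auto simp: KT_def triangle_def)
    then have "f (Inr (Inr (P, (i, j)))) c = 0"
      using fc by blast
    then show "cf (shift P (B c)) i j = 0"
      by (simp add: f_def)
  qed
  \<comment> \<open>In \<open>G c = 0\<close> every term except \<open>t c P * U P\<close> vanishes
    to order \<open>n + 1\<close> at \<open>P\<close>; for \<open>B E\<close> the orders
    \<open>n\<close> and 1 add up. As \<open>U P\<close> is a unit at \<open>P\<close>, the jet
    \<open>t c P\<close> vanishes to that order too, and its coefficients are its own Taylor
    coefficients.\<close>
  have t0: "c (Inr (Inr (P, k))) = 0" if P: "P \<in> W" and k: "k \<in> triangle (Suc n)" for P k
  proof -
    have "t c P * U P + (A c * D + B c * E + (\<Sum>Q\<in>W - {P}. t c Q * U Q)) = 0"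
      using G0 W P by (simp add: G_def sum.remove[of W P] ac_simps)
    then have "t c P * U P = - (A c * D + B c * E + (\<Sum>Q\<in>W - {P}. t c Q * U Q))"
      by (simp only: eq_neg_iff_add_eq_0)
    moreover have "vanish (Suc n) P (A c * D + B c * E + (\<Sum>Q\<in>W - {P}. t c Q * U Q))"
    proof (intro vanish_add vanish_sum)
      show "vanish (Suc n) P (A c * D)"
        by (intro vanish_mult_left DW P)
      show "vanish (Suc n) P (B c * E)"
        using vanish_mult[OF BW[OF P] EW[OF P]] by simp
      show "vanish (Suc n) P (t c Q * U Q)" if "Q \<in> W - {P}" for Q
        using that unfolding U_def by (intro vanish_mult_left vanish_separator W P) auto
    qed
    ultimately have "vanish (Suc n) P (t c P * U P)"
      by (simp only: vanish_uminus)
    then have "vanish (Suc n) P (U P * t c P)"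
      by (subst mult.commute)
    then have "vanish (Suc n) P (t c P)"
      using ev_separator[OF W] unfolding U_def by (rule vanish_cancel[rotated])
    then have "cf (shift P (t c P)) (fst k) (snd k) = 0"
      using k by (auto simp: vanish_def triangle_def)
    then show ?thesis
      using cf_shift_jet_poly[of "fst k" "snd k" "Suc n" P] k by (simp add: t_def)
  qed
  have "t c P = 0" if "P \<in> W" for P
    using t0[OF that] by (auto simp: t_def jet_poly_def intro!: sum.neutral)
  then have rel: "A c * D + B c * E = 0"
    using G0 by (simp add: G_def)
  then have "A c * D = - (B c * E)"
    by (simp only: eq_neg_iff_add_eq_0)
  then have "E dvd A c * D"
    by simp
  then obtain T where T: "A c = E * T"
    using coprime by (metis dvdE)
  \<comment> \<open>Otherwise the product of the leading monomials of \<open>T\<close> and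
    \<open>E\<close> would occur in \<open>A c\<close>, at one of the positions where an equation
    from \<open>KA\<close> makes the coefficient zero.\<close>
  have "T = 0"
  proof (rule ccontr)
    assume T0: "T \<noteq> 0"
    have "degree (lead_coeff T) \<le> degree (swp T)"
    proof -
      have "cf T (degree (lead_coeff T)) (degree T) \<noteq> 0"
        using T0 by (simp add: cf_def)
      then show ?thesis
        by (metis bideg_cf bideg_def order_refl)
    qed
    moreover have "degree (swp T) + u \<le> N - d1" "degree T + v \<le> N - d2"
      using bidegA T0 E0 by (simp_all add: T bideg_def degree_mult_eq u_def v_def add.commute)
    ultimately have "Inr (Inl (degree (lead_coeff T), degree T)) \<in> KC <+> (KA <+> KT)"
      by (auto simp: KA_def)
    then have "f (Inr (Inl (degree (lead_coeff T), degree T))) c = 0"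
      using fc by blast
    then have "cf (A c) (degree (lead_coeff T) + w) (degree T + v) = 0"
      by (simp add: f_def)
    moreover have "coeff (A c) (degree T + v) = lead_coeff T * lead_coeff E"
      by (metis T coeff_mult_degree_sum mult.commute v_def)
    ultimately have "lead_coeff (lead_coeff T) * lead_coeff (lead_coeff E) = 0"
      by (metis cf_def coeff_mult_degree_sum w_def)
    then show False
      using T0 E0 by simp
  qed
  then have A0: "A c = 0"
    using T by simp
  then have B0: "B c = 0"
    using rel E0 by simp
  have "c i = 0" for i
  proof (cases "i \<in> IA <+> (IB <+> IT)")
    case True
    then consider k where "i = Inl k" "k \<in> IA" | k where "i = Inr (Inl k)" "k \<in> IB"
      | P k where "i = Inr (Inr (P, k))" "P \<in> W" "k \<in> triangle (Suc n)"
      by (auto simp: IT_def)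
    then show ?thesis
    proof cases
      case (1 k)
      then show ?thesis
        using arg_cong[OF A0, of "\<lambda>p. cf p (fst k) (snd k)"]
        by (auto simp: A_def IA_def cf_box_poly)
    next
      case (2 k)
      then show ?thesis
        using arg_cong[OF B0, of "\<lambda>p. cf p (fst k) (snd k)"]
        by (auto simp: B_def IB_def cf_box_poly)
    qed (use t0 in simp)
  qed (use c in blast)
  then show False
    using c(2) by blast
qed

section \<open>Curves through a point set imposing independent conditions\<close>

text \<open>Take \<open>W\<close> of least cardinality. Fewer points than coefficients would leave a
  nonzero polynomial through \<open>W\<close>. Conversely, minimality yields for each
  \<open>P\<close> a polynomial \<open>g P\<close> vanishing on \<open>W\<close> except at
  \<open>P\<close>; such polynomials are linearly independent, so there are not more of them than
  coefficients.\<close>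

lemma minimal_unisolvent_subset:
  fixes Z :: "('a::field_char_0 \<times> 'a) set"
  assumes "finite Z"
    and Z: "\<And>p. bideg p d e \<Longrightarrow> (\<And>P. P \<in> Z \<Longrightarrow> vanish (Suc 0) P p) \<Longrightarrow> p = 0"
  obtains W where "W \<subseteq> Z" "card W = Suc d * Suc e"
    "\<And>p. bideg p d e \<Longrightarrow> (\<And>P. P \<in> W \<Longrightarrow> vanish (Suc 0) P p) \<Longrightarrow> p = 0"
proof -
  define ok where "ok = (\<lambda>W. W \<subseteq> Z \<and>
    (\<forall>p. bideg p d e \<longrightarrow> (\<forall>P\<in>W. vanish (Suc 0) P p) \<longrightarrow> p = 0))"
  have "ok Z"
    using Z by (auto simp: ok_def)
  then obtain W where W: "ok W" and min: "\<And>W'. ok W' \<Longrightarrow> card W \<le> card W'"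
    using ex_has_least_nat[of ok Z card] by blast
  have finW: "finite W"
    using W \<open>finite Z\<close> by (auto simp: ok_def intro: finite_subset)
  let ?K = "{..d} \<times> {..e}"
  have cardK: "card ?K = Suc d * Suc e"
    by simp
  have "card ?K \<le> card W"
  proof (rule ccontr)
    assume "\<not> card ?K \<le> card W"
    then obtain c where c: "\<forall>i. i \<notin> ?K \<longrightarrow> c i = 0" "\<exists>i. c i \<noteq> 0"
      and cW: "\<forall>P\<in>W. ev (box_poly d e c) (fst P) (snd P) = 0"
      using homogeneous_system_solution[of ?K W "\<lambda>P c. ev (box_poly d e c) (fst P) (snd P)",
          OF _ finW] by (auto simp: box_poly_add box_poly_smult not_le)
    have "box_poly d e c = 0"
      using W cW by (auto simp: ok_def bideg_box_poly vanish_1_iff)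
    then show False
      using box_poly_nonzero[OF c] by blast
  qed
  moreover have "card W \<le> card ?K"
  proof (rule ccontr)
    assume less: "\<not> card W \<le> card ?K"
    have "\<exists>p. bideg p d e \<and> (\<forall>Q\<in>W - {P}. vanish (Suc 0) Q p) \<and> ev p (fst P) (snd P) \<noteq> 0" if "P \<in> W" for P
    proof -
      have "\<not> ok (W - {P})"
        using min[of "W - {P}"] finW that by (metis card_Diff1_less not_le)
      then obtain p where "bideg p d e" "\<forall>Q\<in>W - {P}. vanish (Suc 0) Q p" "p \<noteq> 0"
        using W by (auto simp: ok_def)
      moreover from this have "\<not> vanish (Suc 0) P p"
        using W by (auto simp: ok_def)
      ultimately show ?thesis
        by (auto simp: vanish_1_iff)
    qed
    then obtain g where "\<forall>P\<in>W. bideg (g P) d e \<and> (\<forall>Q\<in>W - {P}. vanish (Suc 0) Q (g P))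
        \<and> ev (g P) (fst P) (snd P) \<noteq> 0"
      by metis
    then have g: "\<And>P. P \<in> W \<Longrightarrow> bideg (g P) d e"
      "\<And>P Q. P \<in> W \<Longrightarrow> Q \<in> W \<Longrightarrow> Q \<noteq> P \<Longrightarrow> ev (g P) (fst Q) (snd Q) = 0"
      "\<And>P. P \<in> W \<Longrightarrow> ev (g P) (fst P) (snd P) \<noteq> 0"
      by (auto simp: vanish_1_iff)
    define G where "G = (\<lambda>c. \<Sum>P\<in>W. smult [:c P:] (g P))"
    have add: "G (\<lambda>P. x P + y P) = G x + G y" for x y
      by (rule ev_eqI) (simp add: G_def ev_sum distrib_right sum.distrib)
    have scale: "G (\<lambda>P. s * x P) = smult [:s:] (G x)" for s x
      by (rule ev_eqI) (simp add: G_def ev_sum sum_distrib_left mult.assoc)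
    obtain c where c: "\<forall>P. P \<notin> W \<longrightarrow> c P = 0" "\<exists>P. c P \<noteq> 0"
      and cK: "\<forall>k\<in>?K. cf (G c) (fst k) (snd k) = 0"
      using homogeneous_system_solution[of W ?K "\<lambda>k c. cf (G c) (fst k) (snd k)", OF finW] less
      by (auto simp: add scale cf_smult not_le)
    have "bideg (G c) d e"
      unfolding G_def by (intro bideg_sum bideg_smult g)
    then have "G c = 0"
      using cK by (intro cf_eqI) (auto simp: bideg_cf)
    have "c P = 0" if "P \<in> W" for P
    proof -
      have "0 = ev (G c) (fst P) (snd P)"
        using \<open>G c = 0\<close> by simp
      also have "\<dots> = (\<Sum>Q\<in>W. if Q = P then c P * ev (g P) (fst P) (snd P) else 0)"
        unfolding G_def ev_sum using g(2) that by (intro sum.cong refl) auto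
      also have "\<dots> = c P * ev (g P) (fst P) (snd P)"
        using finW that by simp
      finally show ?thesis
        using g(3)[OF that] by simp
    qed
    then show False
      using c by blast
  qed
  ultimately show ?thesis
    using that[of W] W cardK by (auto simp: ok_def)
qed

text \<open>Passing through \<open>W\<close> and being constant on the line at \<open>x\<close>
  costs at most \<open>Suc d * Suc e + e\<close> equations, one less than the number of
  coefficients. The constant is not zero: otherwise the line splits off and leaves a curve of
  bidegree \<open>(d, e)\<close> through \<open>W\<close>. So it can be scaled to 1.\<close>

lemma curve_constant_on_vline:
  fixes W :: "('a::field_char_0 \<times> 'a) set"
  assumes W: "finite W" "card W \<le> Suc d * Suc e"
    and unisolvent: "\<And>p. bideg p d e \<Longrightarrow> (\<And>P. P \<in> W \<Longrightarrow> vanish (Suc 0) P p) \<Longrightarrow> p = 0"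
    and x: "x \<notin> fst ` W"
  obtains p where "bideg p (Suc d) e" "\<And>P. P \<in> W \<Longrightarrow> vanish (Suc 0) P p" "\<And>y. ev p x y = 1"
proof -
  let ?I = "{..Suc d} \<times> {..e}" and ?K = "W <+> {1..e}"
  define p where "p = (\<lambda>c. box_poly (Suc d) e c :: 'a bpoly)"
  define f where "f = (\<lambda>k c. case k of Inl P \<Rightarrow> ev (p c) (fst P) (snd P)
    | Inr j \<Rightarrow> coeff (poly (swp (p c)) [:x:]) j)"
  have "card ?K < card ?I"
    using W by (simp add: card_Plus)
  have "poly (smult [:s:] q) [:x:] = smult s (poly q [:x:])" for s and q :: "'a bpoly"
    by simp
  moreover have "swp (smult [:s:] q) = smult [:s:] (swp q)" for s and q :: "'a bpoly"
    by (rule ev_eqI) simp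
  ultimately have "f k (\<lambda>i. x i + y i) = f k x + f k y" "f k (\<lambda>i. s * x i) = s * f k x" for k s x y
    by (simp_all add: f_def p_def box_poly_add box_poly_smult split: sum.splits)
  then obtain c where c: "\<forall>i. i \<notin> ?I \<longrightarrow> c i = 0" "\<exists>i. c i \<noteq> 0" and fc: "\<forall>k\<in>?K. f k c = 0"
    using homogeneous_system_solution[of ?I ?K f] W(1) \<open>card ?K < card ?I\<close> by auto
  have bideg: "bideg (p c) (Suc d) e"
    by (simp add: p_def bideg_box_poly)
  have pW: "vanish (Suc 0) P (p c)" if "P \<in> W" for P
    using fc that by (force simp: f_def vanish_1_iff)
  define r where "r = poly (swp (p c)) [:x:]"
  have "coeff r j = 0" if "j \<noteq> 0" for j
  proof (cases "j \<le> e")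
    case True
    then have "Inr j \<in> ?K"
      using that by auto
    then have "f (Inr j) c = 0"
      using fc by blast
    then show ?thesis
      by (simp add: f_def r_def)
  next
    case False
    then show ?thesis
      using degree_poly_vline[OF bideg, of x] by (simp add: r_def coeff_eq_0)
  qed
  then have rc: "r = [:coeff r 0:]"
    by (auto simp: poly_eq_iff coeff_pCons split: nat.splits)
  then have r: "ev (p c) x y = coeff r 0" for y
    by (metis poly_vline r_def poly_const_conv)
  have "coeff r 0 \<noteq> 0"
  proof
    assume "coeff r 0 = 0"
    then have "poly (swp (p c)) [:x:] = 0"
      using rc by (simp add: r_def)
    then obtain q where q: "p c = vline x * q"
      by (rule vline_dvd)
    have "p c \<noteq> 0"
      unfolding p_def by (rule box_poly_nonzero[OF c])
    then have "q \<noteq> 0"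
      using q by auto
    then have "bideg q d e"
      using bideg_vline_mult(2)[of x q "Suc d" e] bideg q by simp
    moreover have "vanish (Suc 0) P q" if "P \<in> W" for P
    proof (rule vanish_cancel)
      show "ev (vline x) (fst P) (snd P) \<noteq> 0"
        using x that by auto
    qed (use pW[OF that] q in simp)
    ultimately show False
      using unisolvent \<open>q \<noteq> 0\<close> by blast
  qed
  then have "ev (smult [:inverse (coeff r 0):] (p c)) x y = 1" for y
    by (simp only: ev_smult r) simp
  then show ?thesis
    using that[OF bideg_smult[OF bideg] vanish_smult[OF pW]] by blast
qed

lemma curve_constant_on_hline:
  fixes W :: "('a::field_char_0 \<times> 'a) set"
  assumes W: "finite W" "card W \<le> Suc d * Suc e"
    and unisolvent: "\<And>p. bideg p d e \<Longrightarrow> (\<And>P. P \<in> W \<Longrightarrow> vanish (Suc 0) P p) \<Longrightarrow> p = 0"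
    and y: "y \<notin> snd ` W"
  obtains p where "bideg p d (Suc e)" "\<And>P. P \<in> W \<Longrightarrow> vanish (Suc 0) P p" "\<And>x. ev p x y = 1"
proof -
  have swap: "vanish (Suc 0) P (swp p) \<longleftrightarrow> vanish (Suc 0) (prod.swap P) p" for P and p :: "'a bpoly"
    by (simp add: vanish_1_iff)
  obtain p where "bideg p (Suc e) d" "\<And>P. P \<in> prod.swap ` W \<Longrightarrow> vanish (Suc 0) P p"
    "\<And>x. ev p y x = 1"
  proof (rule curve_constant_on_vline[of "prod.swap ` W" e d y])
    show "finite (prod.swap ` W)" "card (prod.swap ` W) \<le> Suc e * Suc d"
      using W by (simp_all add: card_image mult.commute)
    show "y \<notin> fst ` prod.swap ` W"
      using y by (auto simp: image_image)
    show "p = 0" if "bideg p e d" "\<And>P. P \<in> prod.swap ` W \<Longrightarrow> vanish (Suc 0) P p" for p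
      using unisolvent[of "swp p"] that by (auto simp: swap)
  qed blast
  then show ?thesis
    using that[of "swp p"] by (auto simp: swap)
qed

text \<open>A common factor \<open>G\<close> is a unit on the vertical line at \<open>x\<close>, so
  all coefficients of positive \<open>y\<close>-degree vanish at \<open>x\<close>. The leading one
  does not, since it divides that of \<open>D\<close>; hence \<open>G\<close> involves only
  \<open>x\<close>. Being a unit on a horizontal line as well, it is constant.\<close>

lemma prime_not_dvd_both:
  fixes G E1 E2 D :: "complex bpoly"
  assumes "prime G" "G dvd D" and x: "poly (lead_coeff D) x \<noteq> 0"
    and E1: "\<And>y. ev E1 x y = 1" and E2: "\<And>x. ev E2 x y0 = 1"
  shows "\<not> (G dvd E1 \<and> G dvd E2)"
proof
  assume dvd: "G dvd E1 \<and> G dvd E2"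
  obtain R where "D = G * R"
    using \<open>G dvd D\<close> by blast
  then have lc: "poly (lead_coeff G) x \<noteq> 0"
    using x by (auto simp: lead_coeff_mult)
  obtain T where "E1 = G * T"
    using dvd by blast
  then have "ev G x y * ev T x y = 1" for y
    using E1 by simp
  then have "poly (poly (swp G) [:x:] * poly (swp T) [:x:]) = poly 1"
    by (auto simp: poly_vline fun_eq_iff)
  then have "poly (swp G) [:x:] * poly (swp T) [:x:] = 1"
    by (simp only: poly_eq_poly_eq_iff)
  then have "poly (swp G) [:x:] dvd 1"
    by (metis dvdI)
  then have "degree (poly (swp G) [:x:]) = 0"
    by (metis is_unit_iff_degree not_is_unit_0)
  moreover have "coeff (poly (swp G) [:x:]) j = poly (coeff G j) x" for j
  proof -
    have "poly (map_poly (\<lambda>q. poly q x) p) y = ev p x y" for p :: "complex bpoly" and y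
      by (induction p) (simp_all add: ev_def map_poly_pCons algebra_simps)
    then have "poly (swp G) [:x:] = map_poly (\<lambda>q. poly q x) G"
      by (intro poly_ext) (simp add: poly_vline)
    then show ?thesis
      by (simp add: coeff_map_poly)
  qed
  ultimately have "degree G = 0"
    using lc by (metis le_degree le_zero_eq)
  then obtain g where g: "G = [:g:]"
    by (metis degree_eq_zeroE)
  obtain S where "E2 = G * S"
    using dvd by blast
  then have "ev G x y0 * ev S x y0 = 1" for x
    using E2 by simp
  then have "poly (g * poly S [:y0:]) = poly 1"
    by (auto simp: ev_def g fun_eq_iff)
  then have "g * poly S [:y0:] = 1"
    by (simp only: poly_eq_poly_eq_iff)
  then have "is_unit g"
    by (metis dvdI)
  then have "is_unit G"
    by (simp add: g is_unit_const_poly_iff)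
  then show False
    using \<open>prime G\<close> by (simp add: prime_def prime_elem_def)
qed

text \<open>Each prime factor of \<open>D\<close> divides \<open>E1 + c E2\<close> for at most one
  \<open>c\<close>: from two such values it would divide \<open>E2\<close>, and then
  \<open>E1\<close>. Finitely many values are to be avoided, and the field is infinite.\<close>

lemma coprime_linear_combination:
  fixes D E1 E2 :: "complex bpoly"
  assumes D: "D \<noteq> 0" and E: "E1 \<noteq> 0"
    and prime: "\<And>G. prime G \<Longrightarrow> G dvd D \<Longrightarrow> \<not> (G dvd E1 \<and> G dvd E2)"
  obtains c where "E1 + smult [:c:] E2 \<noteq> 0" "coprime (E1 + smult [:c:] E2) D"
proof -
  have ev_comb: "smult [:a:] E2 - smult [:b:] E2 = smult [:a - b:] E2" for a b
    by (simp add: smult_diff_left[symmetric])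
  have uniq: "a = b" if G: "\<not> (G dvd E1 \<and> G dvd E2)"
    and "G dvd E1 + smult [:a:] E2" "G dvd E1 + smult [:b:] E2" for G a b
  proof (rule ccontr)
    assume "a \<noteq> b"
    have "G dvd (E1 + smult [:a:] E2) - (E1 + smult [:b:] E2)"
      using that by (intro dvd_diff)
    then have "G dvd smult [:a - b:] E2"
      by (simp add: ev_comb)
    then have "G dvd smult [:inverse (a - b):] (smult [:a - b:] E2)"
      by (rule dvd_smult)
    then have E2: "G dvd E2"
      using \<open>a \<noteq> b\<close> by (simp add: one_pCons[symmetric])
    then have "G dvd (E1 + smult [:a:] E2) - smult [:a:] E2"
      using that by (intro dvd_diff dvd_smult)
    then show False
      using G E2 by simp
  qed
  \<comment> \<open>The set \<open>bad 0\<close> consists of the values for which the combination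
    itself is zero, so the same argument also secures that it is nonzero.\<close>
  define bad where "bad = (\<lambda>G. {c. G dvd E1 + smult [:c:] E2})"
  have fin: "finite (bad G)" if "\<not> (G dvd E1 \<and> G dvd E2)" for G
  proof (cases "bad G = {}")
    case False
    then obtain c where "c \<in> bad G"
      by blast
    then have "bad G \<subseteq> {c}"
      using uniq[OF that] by (auto simp: bad_def)
    then show ?thesis
      using finite_subset by blast
  qed simp
  have "finite (bad 0 \<union> (\<Union>G\<in>prime_factors D. bad G))"
    using E D prime by (intro finite_UnI finite_UN_I finite_set_mset fin) (auto simp: prime_factors_dvd)
  then obtain c where c: "c \<notin> bad 0 \<union> (\<Union>G\<in>prime_factors D. bad G)"
    using ex_new_if_finite infinite_UNIV_char_0 by blast
  have "coprime (E1 + smult [:c:] E2) D"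
  proof (rule ccontr)
    let ?g = "gcd (E1 + smult [:c:] E2) D"
    assume "\<not> coprime (E1 + smult [:c:] E2) D"
    then have "\<not> is_unit ?g"
      by (simp add: coprime_iff_gcd_eq_1 is_unit_gcd)
    moreover have "?g \<noteq> 0"
      using D by simp
    ultimately obtain G where "prime G" "G dvd ?g"
      using prime_divisor_exists by blast
    then have "G \<in> prime_factors D" "c \<in> bad G"
      using D by (auto simp: prime_factors_dvd bad_def)
    then show False
      using c by blast
  qed
  then show ?thesis
    using that[of c] c by (auto simp: bad_def)
qed

text \<open>The curve \<open>E\<close> of bidegree \<open>(b + 1, b + 1)\<close> meets \<open>D\<close> properly and passes through
  \<open>(b + 1)\<^sup>2\<close> of the points.\<close>

proposition unisolvent_multiplicity_bound:
  fixes Z :: "(complex \<times> complex) set" and D :: "complex bpoly"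
  assumes "finite Z"
    and Z: "\<And>p. bideg p b b \<Longrightarrow> (\<And>P. P \<in> Z \<Longrightarrow> vanish (Suc 0) P p) \<Longrightarrow> p = 0"
    and D: "D \<noteq> 0" "bideg D d d" "\<And>P. P \<in> Z \<Longrightarrow> vanish m P D"
  shows "m * Suc b \<le> 2 * d"
proof (cases m)
  case (Suc n)
  obtain W where W: "W \<subseteq> Z" "card W = Suc b * Suc b"
    and unisolvent: "\<And>p. bideg p b b \<Longrightarrow> (\<And>P. P \<in> W \<Longrightarrow> vanish (Suc 0) P p) \<Longrightarrow> p = 0"
    using minimal_unisolvent_subset[OF \<open>finite Z\<close>, of b b] Z by metis
  have finW: "finite W"
    using W \<open>finite Z\<close> finite_subset by blast
  \<comment> \<open>The vertical line has to miss \<open>W\<close>, for \<open>E1\<close> to exist,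
    and the zeros of the leading coefficient of \<open>D\<close>, for
    \<open>prime_not_dvd_both\<close>.\<close>
  have "finite (fst ` W \<union> {x. poly (lead_coeff D) x = 0})"
    using finW D(1) by (auto intro: poly_roots_finite)
  then obtain x where "x \<notin> fst ` W \<union> {x. poly (lead_coeff D) x = 0}"
    using ex_new_if_finite[OF infinite_UNIV_char_0] by blast
  then have x: "x \<notin> fst ` W" "poly (lead_coeff D) x \<noteq> 0"
    by simp_all
  have "finite (snd ` W)"
    using finW by simp
  then obtain y where y: "y \<notin> snd ` W"
    using ex_new_if_finite[OF infinite_UNIV_char_0] by blast
  have card: "card W \<le> Suc b * Suc b"
    by (simp only: W(2))
  obtain E1 where E1: "bideg E1 (Suc b) b" "\<And>P. P \<in> W \<Longrightarrow> vanish (Suc 0) P E1" "\<And>y. ev E1 x y = 1"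
    using curve_constant_on_vline[OF finW card unisolvent x(1)] by blast
  obtain E2 where E2: "bideg E2 b (Suc b)" "\<And>P. P \<in> W \<Longrightarrow> vanish (Suc 0) P E2" "\<And>x. ev E2 x y = 1"
    using curve_constant_on_hline[OF finW card unisolvent y] by blast
  have "E1 \<noteq> 0"
    using E1(3) by force
  then obtain c where c: "E1 + smult [:c:] E2 \<noteq> 0" "coprime (E1 + smult [:c:] E2) D"
    using coprime_linear_combination[OF D(1) _ prime_not_dvd_both[OF _ _ x(2) E1(3) E2(3)]] by blast
  define E where "E = E1 + smult [:c:] E2"
  have "bideg E (Suc b) (Suc b)"
    unfolding E_def using E1(1) E2(1) by (intro bideg_add bideg_smult) (auto elim: bideg_mono)
  then have deg: "degree E + degree (swp E) \<le> 2 * Suc b"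
    by (auto simp: bideg_def)
  have "Suc n * card W \<le> d * degree E + d * degree (swp E)"
  proof (rule bezout_inequality[OF finW D(2)])
    show "vanish (Suc n) P D" if "P \<in> W" for P
      using D(3) W(1) that Suc by blast
    show "vanish (Suc 0) P E" if "P \<in> W" for P
      unfolding E_def using E1(2) E2(2) that by (intro vanish_add vanish_smult)
    show "E dvd A" if "E dvd A * D" for A
      using that c by (simp add: E_def coprime_dvd_mult_left_iff)
  qed (use c in \<open>simp add: E_def\<close>)
  also have "\<dots> \<le> d * (2 * Suc b)"
    using deg by (metis add_mult_distrib2 mult_le_mono2)
  finally have "(m * Suc b) * Suc b \<le> (2 * d) * Suc b"
    by (simp add: W(2) Suc algebra_simps)
  then show ?thesis
    by (simp only: mult_le_cancel2)
qed simp

section \<open>Stripping lines\<close>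

lemma prod_linear_power_dvd:
  fixes r :: "complex poly"
  assumes "finite K" "inj_on f K" "\<And>k. k \<in> K \<Longrightarrow> [:- f k, 1:] ^ m k dvd r"
  shows "(\<Prod>k\<in>K. [:- f k, 1:] ^ m k) dvd r"
  using assms
proof (induction K rule: finite_induct)
  case (insert k K)
  have "coprime ([:- f k, 1:] ^ m k) (\<Prod>k\<in>K. [:- f k, 1:] ^ m k)"
  proof (rule prod_coprime_right)
    fix l assume "l \<in> K"
    then have "f k \<noteq> f l"
      using insert.hyps(2) insert.prems(1) by (auto simp: inj_on_def)
    have "coprime [:- f k, 1:] [:- f l, 1:]"
    proof (rule coprimeI)
      fix c assume "c dvd [:- f k, 1:]" "c dvd [:- f l, 1:]"
      then have "c dvd [:- f k, 1:] - [:- f l, 1:]"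
        by (rule dvd_diff)
      moreover have "is_unit ([:- f k, 1:] - [:- f l, 1:])"
        using \<open>f k \<noteq> f l\<close> by (simp add: is_unit_const_poly_iff dvd_field_iff)
      ultimately show "is_unit c"
        by (rule dvd_trans)
    qed
    then show "coprime ([:- f k, 1:] ^ m k) ([:- f l, 1:] ^ m l)"
      by simp
  qed
  then show ?case
    using insert by (auto intro!: divides_mult)
qed simp

lemma degree_prod_linear_power:
  "degree (\<Prod>k\<in>K. [:- f k, 1:] ^ m k) = (\<Sum>k\<in>K. m k)" for f :: "'b \<Rightarrow> complex"
proof -
  have "[:- f k, 1:] ^ m k \<noteq> 0" "degree ([:- f k, 1:] ^ m k) = m k" for k
    by (simp_all add: degree_linear_power)
  then show ?thesis
    by (subst degree_prod_sum_eq) simp_all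
qed

text \<open>The row of exponent 0 in \<open>y\<close> of the translated polynomial is the
  restriction \<open>p(x + a, b)\<close>; its coefficients below \<open>m\<close> vanish.\<close>

lemma vanish_hline_dvd:
  fixes p :: "complex bpoly"
  assumes "vanish m (a, b) p"
  shows "[:- a, 1:] ^ m dvd poly p [:b:]"
proof -
  have "poly (coeff q 0) x = ev q x 0" for q :: "complex bpoly" and x
    by (simp add: ev_def flip: poly_0_coeff_0)
  then have r: "poly (coeff (shift (a, b) p) 0) x = ev p (x + a) b" for x
    by simp
  have "monom 1 m dvd coeff (shift (a, b) p) 0"
    using assms by (auto simp: monom_1_dvd_iff' vanish_def cf_def)
  then obtain q where q: "coeff (shift (a, b) p) 0 = monom 1 m * q"
    by blast
  have "poly p [:b:] = [:- a, 1:] ^ m * pcompose q [:- a, 1:]"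
  proof (rule poly_ext)
    fix x
    have "poly (poly p [:b:]) x = poly (coeff (shift (a, b) p) 0) (x - a)"
      by (simp add: r poly_hline)
    then show "poly (poly p [:b:]) x = poly ([:- a, 1:] ^ m * pcompose q [:- a, 1:]) x"
      by (simp add: q poly_monom poly_pcompose)
  qed
  then show ?thesis
    by simp
qed

text \<open>Points with multiplicities are kept in an explicit list so that the simplifier can
  compute both the sum over a line and the list left after the line is removed.\<close>

definition admits :: "nat \<Rightarrow> nat \<Rightarrow> ((complex \<times> complex) \<times> nat) list \<Rightarrow> bool" where
  "admits d e L \<longleftrightarrow> (\<exists>p. p \<noteq> 0 \<and> bideg p d e \<and> (\<forall>(P, m)\<in>set L. vanish m P p))"

text \<open>The restriction to the line has degree at most \<open>d\<close> but is divisible by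
  coprime powers of larger total degree, so it is zero and the line splits off. That lowers the
  multiplicities on it by one, and the other points do not notice. With \<open>e = 0\<close> the
  conclusion \<open>0 < e\<close> is the contradiction that ends a reduction.\<close>

lemma strip_hline:
  assumes "admits d e L" "distinct (map fst L)"
    and less: "d < sum_list (map snd (filter (\<lambda>(P, m). snd P = b) L))"
  shows "0 < e" "admits d (e - 1) (map (\<lambda>(P, m). (P, if snd P = b then m - 1 else m)) L)"
proof -
  obtain p where p: "p \<noteq> 0" "bideg p d e" and L: "\<And>P m. (P, m) \<in> set L \<Longrightarrow> vanish m P p"
    using assms(1) unfolding admits_def by blast
  define K where "K = set (filter (\<lambda>(P, m). snd P = b) L)"
  have "distinct L" "inj_on fst (set L)"
    using assms(2) by (auto simp: distinct_map)
  then have "d < (\<Sum>k\<in>K. snd k)"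
    using less by (simp add: K_def sum_list_distinct_conv_sum_set)
  moreover have "inj_on (\<lambda>k. fst (fst k)) K"
    unfolding inj_on_def
  proof (intro ballI impI)
    fix k l assume kl: "k \<in> K" "l \<in> K" "fst (fst k) = fst (fst l)"
    then have "fst k = fst l"
      by (auto simp: K_def prod_eq_iff)
    then show "k = l"
      using kl inj_onD[OF \<open>inj_on fst (set L)\<close>] by (auto simp: K_def)
  qed
  then have dvd: "(\<Prod>k\<in>K. [:- fst (fst k), 1:] ^ snd k) dvd poly p [:b:]"
    using L by (intro prod_linear_power_dvd) (auto simp: K_def intro!: vanish_hline_dvd)
  ultimately have "degree (poly p [:b:]) < degree (\<Prod>k\<in>K. [:- fst (fst k), 1:] ^ snd k)"
    unfolding degree_prod_linear_power using degree_poly_hline[OF p(2), of b] by linarith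
  then have "poly p [:b:] = 0"
    using dvd_imp_degree_le[OF dvd] not_le by blast
  then obtain q where q: "p = hline b * q"
    by (rule hline_dvd)
  then have "q \<noteq> 0"
    using p by auto
  have "vanish (m - 1) (a, b) q" if "((a, b), m) \<in> set L" for a m
  proof -
    have "vanish m (b, a) (vline b * swp q)"
      using L[OF that] by (simp add: q vanish_swp flip: swp_hline swp_mult)
    then show ?thesis
      using vanish_vline_cancel[of m "(b, a)" "swp q"] by (simp add: vanish_swp)
  qed
  moreover have "vanish m P q" if "(P, m) \<in> set L" "snd P \<noteq> b" for P m
    using L[OF that(1)] that(2) unfolding q by (intro vanish_cancel[of "hline b" P m q]) auto
  ultimately show "0 < e" "admits d (e - 1) (map (\<lambda>(P, m). (P, if snd P = b then m - 1 else m)) L)"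
    using bideg_hline_mult[of b q d e] p(2) \<open>q \<noteq> 0\<close>
    unfolding admits_def q by (auto intro!: exI[of _ q])
qed

lemma admits_swap:
  assumes "admits d e L"
  shows "admits e d (map (\<lambda>(P, m). (prod.swap P, m)) L)"
proof -
  obtain p where "p \<noteq> 0" "bideg p d e" "\<forall>(P, m)\<in>set L. vanish m P p"
    using assms unfolding admits_def by blast
  then show ?thesis
    unfolding admits_def by (intro exI[of _ "swp p"]) (auto simp: vanish_swp)
qed

lemma strip_vline:
  assumes "admits d e L" "distinct (map fst L)"
    and less: "e < sum_list (map snd (filter (\<lambda>(P, m). fst P = a) L))"
  shows "0 < d" "admits (d - 1) e (map (\<lambda>(P, m). (P, if fst P = a then m - 1 else m)) L)"
proof -
  let ?L = "map (\<lambda>(P, m). (prod.swap P, m)) L"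
  have "map fst ?L = map prod.swap (map fst L)"
    by (simp add: o_def split_def)
  then have "distinct (map fst ?L)"
    using assms(2) by (metis distinct_map inj_on_subset inj_swap subset_UNIV)
  moreover have "map snd (filter (\<lambda>(P, m). snd P = a) ?L) = map snd (filter (\<lambda>(P, m). fst P = a) L)"
    by (simp add: filter_map o_def split_def)
  ultimately have "0 < d"
    and "admits e (d - 1) (map (\<lambda>(P, m). (P, if snd P = a then m - 1 else m)) ?L)"
    using strip_hline[OF admits_swap[OF assms(1)], of a] less by simp_all
  then show "0 < d" "admits (d - 1) e (map (\<lambda>(P, m). (P, if fst P = a then m - 1 else m)) L)"
    using admits_swap[of e "d - 1"] by (fastforce simp: o_def split_def cong: if_cong)+
qed

text \<open>In the next three lemmas a line of bidegree \<open>(1, 0)\<close> or \<open>(0, 1)\<close> is a component as soon as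
  its intersection number with the curve is less than the sum of the multiplicities on it.\<close>

lemma path4_not_admits_7:
  assumes "x0 \<noteq> x1" "y0 \<noteq> y1" "y0 \<noteq> y2" "y1 \<noteq> y2"
  shows "\<not> admits 7 7 [((x0, y0), 6), ((x0, y1), 6), ((x1, y0), 6), ((x1, y2), 6)]"
proof
  note [simp] = assms assms[symmetric]
  assume "admits 7 7 [((x0, y0), 6), ((x0, y1), 6), ((x1, y0), 6), ((x1, y2), 6)]"
  from strip_vline(2)[OF this, of x0] have "admits 6 7 [((x0, y0), 5), ((x0, y1), 5), ((x1, y0), 6), ((x1, y2), 6)]" by simp
  from strip_vline(2)[OF this, of x1] have "admits 5 7 [((x0, y0), 5), ((x0, y1), 5), ((x1, y0), 5), ((x1, y2), 5)]" by simp
  from strip_vline(2)[OF this, of x0] have "admits 4 7 [((x0, y0), 4), ((x0, y1), 4), ((x1, y0), 5), ((x1, y2), 5)]" by simp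
  from strip_vline(2)[OF this, of x1] have "admits 3 7 [((x0, y0), 4), ((x0, y1), 4), ((x1, y0), 4), ((x1, y2), 4)]" by simp
  from strip_vline(2)[OF this, of x0] have "admits 2 7 [((x0, y0), 3), ((x0, y1), 3), ((x1, y0), 4), ((x1, y2), 4)]" by simp
  from strip_vline(2)[OF this, of x1] have "admits 1 7 [((x0, y0), 3), ((x0, y1), 3), ((x1, y0), 3), ((x1, y2), 3)]" by simp
  from strip_hline(2)[OF this, of y0] have "admits 1 6 [((x0, y0), 2), ((x0, y1), 3), ((x1, y0), 2), ((x1, y2), 3)]" by simp
  from strip_hline(2)[OF this, of y0] have "admits 1 5 [((x0, y0), 1), ((x0, y1), 3), ((x1, y0), 1), ((x1, y2), 3)]" by simp
  from strip_hline(2)[OF this, of y1] have "admits 1 4 [((x0, y0), 1), ((x0, y1), 2), ((x1, y0), 1), ((x1, y2), 3)]" by simp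
  from strip_hline(2)[OF this, of y2] have "admits 1 3 [((x0, y0), 1), ((x0, y1), 2), ((x1, y0), 1), ((x1, y2), 2)]" by simp
  from strip_hline(2)[OF this, of y0] have "admits 1 2 [((x0, y0), 0), ((x0, y1), 2), ((x1, y0), 0), ((x1, y2), 2)]" by simp
  from strip_hline(2)[OF this, of y1] have "admits 1 1 [((x0, y0), 0), ((x0, y1), 1), ((x1, y0), 0), ((x1, y2), 2)]" by simp
  from strip_hline(2)[OF this, of y2] have "admits 1 0 [((x0, y0), 0), ((x0, y1), 1), ((x1, y0), 0), ((x1, y2), 1)]" by simp
  from strip_vline(2)[OF this, of x0] have "admits 0 0 [((x0, y0), 0), ((x0, y1), 0), ((x1, y0), 0), ((x1, y2), 1)]" by simp
  from strip_vline(1)[OF this, of x1] show False by simp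
qed

lemma path3_edge_not_admits_7:
  assumes "x0 \<noteq> x1" "x0 \<noteq> x2" "x1 \<noteq> x2" "y0 \<noteq> y1" "y0 \<noteq> y2" "y1 \<noteq> y2"
  shows "\<not> admits 7 7 [((x0, y0), 6), ((x0, y1), 6), ((x1, y1), 6), ((x2, y2), 6)]"
proof
  note [simp] = assms assms[symmetric]
  assume "admits 7 7 [((x0, y0), 6), ((x0, y1), 6), ((x1, y1), 6), ((x2, y2), 6)]"
  from strip_vline(2)[OF this, of x0] have "admits 6 7 [((x0, y0), 5), ((x0, y1), 5), ((x1, y1), 6), ((x2, y2), 6)]" by simp
  from strip_hline(2)[OF this, of y1] have "admits 6 6 [((x0, y0), 5), ((x0, y1), 4), ((x1, y1), 5), ((x2, y2), 6)]" by simp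
  from strip_vline(2)[OF this, of x0] have "admits 5 6 [((x0, y0), 4), ((x0, y1), 3), ((x1, y1), 5), ((x2, y2), 6)]" by simp
  from strip_hline(2)[OF this, of y1] have "admits 5 5 [((x0, y0), 4), ((x0, y1), 2), ((x1, y1), 4), ((x2, y2), 6)]" by simp
  from strip_vline(2)[OF this, of x2] have "admits 4 5 [((x0, y0), 4), ((x0, y1), 2), ((x1, y1), 4), ((x2, y2), 5)]" by simp
  from strip_hline(2)[OF this, of y2] have "admits 4 4 [((x0, y0), 4), ((x0, y1), 2), ((x1, y1), 4), ((x2, y2), 4)]" by simp
  from strip_vline(2)[OF this, of x0] have "admits 3 4 [((x0, y0), 3), ((x0, y1), 1), ((x1, y1), 4), ((x2, y2), 4)]" by simp
  from strip_hline(2)[OF this, of y1] have "admits 3 3 [((x0, y0), 3), ((x0, y1), 0), ((x1, y1), 3), ((x2, y2), 4)]" by simp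
  from strip_vline(2)[OF this, of x2] have "admits 2 3 [((x0, y0), 3), ((x0, y1), 0), ((x1, y1), 3), ((x2, y2), 3)]" by simp
  from strip_hline(2)[OF this, of y2] have "admits 2 2 [((x0, y0), 3), ((x0, y1), 0), ((x1, y1), 3), ((x2, y2), 2)]" by simp
  from strip_vline(2)[OF this, of x0] have "admits 1 2 [((x0, y0), 2), ((x0, y1), 0), ((x1, y1), 3), ((x2, y2), 2)]" by simp
  from strip_hline(2)[OF this, of y1] have "admits 1 1 [((x0, y0), 2), ((x0, y1), 0), ((x1, y1), 2), ((x2, y2), 2)]" by simp
  from strip_vline(2)[OF this, of x0] have "admits 0 1 [((x0, y0), 1), ((x0, y1), 0), ((x1, y1), 2), ((x2, y2), 2)]" by simp
  from strip_hline(2)[OF this, of y1] have "admits 0 0 [((x0, y0), 1), ((x0, y1), 0), ((x1, y1), 1), ((x2, y2), 2)]" by simp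
  from strip_vline(1)[OF this, of x0] show False by simp
qed

lemma path4_not_admits_diagonal:
  assumes "x0 \<noteq> x1" "y0 \<noteq> y1" "y0 \<noteq> y2" "y1 \<noteq> y2" "0 < m" "m \<le> 5"
  shows "\<not> admits m m [((x0, y0), m), ((x0, y1), m), ((x1, y0), m), ((x1, y2), m)]"
proof
  note [simp] = assms(1-4) assms(1-4)[symmetric]
  assume a: "admits m m [((x0, y0), m), ((x0, y1), m), ((x1, y0), m), ((x1, y2), m)]"
  \<comment> \<open>Both vertical lines are removed: each meets the curve in \<open>m\<close> points
    at most and carries total multiplicity \<open>2 * k\<close>. For odd \<open>m\<close> the degree
    in \<open>x\<close> comes down to 1 while \<open>m < 2 * k\<close> still holds, which
    contradicts \<open>2 <= d\<close>. For even \<open>m\<close> it reaches 0, and horizontal lines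
    have to finish.\<close>
  have step: "admits (d - 2) m [((x0, y0), k - 1), ((x0, y1), k - 1), ((x1, y0), k - 1), ((x1, y2), k - 1)] \<and> 2 \<le> d"
    if "admits d m [((x0, y0), k), ((x0, y1), k), ((x1, y0), k), ((x1, y2), k)]" "m < 2 * k" for d k
  proof -
    have "admits (d - 1) m [((x0, y0), k - 1), ((x0, y1), k - 1), ((x1, y0), k), ((x1, y2), k)]"
      using strip_vline(2)[OF that(1), of x0] that(2) by simp
    from strip_vline[OF this, of x1] show ?thesis
      using that(2) by (simp add: numeral_2_eq_2)
  qed
  have "m = 1 \<or> m = 2 \<or> m = 3 \<or> m = 4 \<or> m = 5"
    using assms(5,6) by linarith
  then show False
  proof (elim disjE)
    assume "m = 2"
    with a step[of 2 2] have "admits 0 2 [((x0, y0), 1), ((x0, y1), 1), ((x1, y0), 1), ((x1, y2), 1)]" by simp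
    from strip_hline(2)[OF this, of y0] have "admits 0 1 [((x0, y0), 0), ((x0, y1), 1), ((x1, y0), 0), ((x1, y2), 1)]" by simp
    from strip_hline(2)[OF this, of y1] have "admits 0 0 [((x0, y0), 0), ((x0, y1), 0), ((x1, y0), 0), ((x1, y2), 1)]" by simp
    from strip_hline(1)[OF this, of y2] show False by simp
  next
    assume "m = 4"
    with a step[of 4 4] step[of 2 3]
    have "admits 0 4 [((x0, y0), 2), ((x0, y1), 2), ((x1, y0), 2), ((x1, y2), 2)]" by simp
    from strip_hline(2)[OF this, of y0] have "admits 0 3 [((x0, y0), 1), ((x0, y1), 2), ((x1, y0), 1), ((x1, y2), 2)]" by simp
    from strip_hline(2)[OF this, of y0] have "admits 0 2 [((x0, y0), 0), ((x0, y1), 2), ((x1, y0), 0), ((x1, y2), 2)]" by simp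
    from strip_hline(2)[OF this, of y1] have "admits 0 1 [((x0, y0), 0), ((x0, y1), 1), ((x1, y0), 0), ((x1, y2), 2)]" by simp
    from strip_hline(2)[OF this, of y1] have "admits 0 0 [((x0, y0), 0), ((x0, y1), 0), ((x1, y0), 0), ((x1, y2), 2)]" by simp
    from strip_hline(1)[OF this, of y2] show False by simp
  qed (use a step[of 1 1] step[of 3 3] step[of 1 2] step[of 5 5] step[of 3 4] step[of 1 3] in simp_all)
qed

section \<open>Four points on no curve of bidegree (1, 1)\<close>

lemma box_poly_cf: "bideg p d e \<Longrightarrow> box_poly d e (\<lambda>(i, j). cf p i j) = p"
  by (rule cf_eqI) (auto simp: cf_box_poly bideg_cf)

lemma ev_expand:
  assumes "bideg p d e"
  shows "ev p x y = (\<Sum>(i, j)\<in>{..d} \<times> {..e}. cf p i j * x ^ i * y ^ j)"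
proof -
  have "ev p x y = ev (box_poly d e (\<lambda>(i, j). cf p i j)) x y"
    using assms by (simp add: box_poly_cf)
  also have "\<dots> = (\<Sum>(i, j)\<in>{..d} \<times> {..e}. cf p i j * x ^ i * y ^ j)"
    unfolding box_poly_def ev_sum
    by (intro sum.cong refl) (auto simp: ev_def poly_monom)
  finally show ?thesis .
qed

lemma ev_expand_outer: "degree p \<le> e \<Longrightarrow> ev p x y = (\<Sum>j\<le>e. poly (coeff p j) x * y ^ j)"
  for p :: "'a::comm_semiring_1 bpoly"
proof -
  assume "degree p \<le> e"
  then have "poly p [:y:] = (\<Sum>j\<le>e. coeff p j * [:y:] ^ j)"
    unfolding poly_altdef by (intro sum.mono_neutral_left) (auto simp: coeff_eq_0 not_le[symmetric])
  then show ?thesis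
    by (simp add: ev_def poly_sum)
qed

lemma bideg_shift:
  fixes p :: "complex bpoly"
  assumes "bideg p d e"
  shows "bideg (shift P p) d e"
proof -
  define a where "a = - fst P"
  define b where "b = - snd P"
  let ?q = "\<Sum>(i, j)\<in>{..d} \<times> {..e}. smult [:cf p i j:] (vline a ^ i * hline b ^ j)"
  have "shift P p = ?q"
    by (rule ev_eqI) (simp add: ev_expand[OF assms] ev_sum split_def mult.assoc a_def b_def)
  moreover have "bideg ?q d e"
  proof (rule bideg_sum)
    fix k assume "k \<in> {..d} \<times> {..e}"
    then obtain i j where k: "k = (i, j)" "i \<le> d" "j \<le> e"
      by auto
    have "bideg (vline a ^ i * hline b ^ j) (i * 1 + j * 0) (i * 0 + j * 1)"
      by (intro bideg_mult bideg_power bideg_vline bideg_hline)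
    then show "bideg (case k of (i, j) \<Rightarrow> smult [:cf p i j:] (vline a ^ i * hline b ^ j)) d e"
      using k by (auto intro!: bideg_smult elim: bideg_mono)
  qed
  ultimately show ?thesis
    by simp
qed

text \<open>\<open>g\<close> is the restriction of the curve \<open>D\<close> to the rational curve \<open>y = R / S\<close>.\<close>

lemma restriction_to_graph_dvd:
  fixes D :: "complex bpoly" and R S :: "complex poly"
  assumes D: "bideg D d e" "vanish m (a, b) D" and S: "S \<noteq> 0" and ab: "poly R a = b * poly S a"
    and g: "g = (\<Sum>j\<le>e. coeff D j * R ^ j * S ^ (e - j))"
  shows "[:- a, 1:] ^ m dvd g"
proof -
  define T where "T = shift (a, b) D"
  \<comment> \<open>The same restriction computed from the Taylor expansion of \<open>D\<close> at
    \<open>(a, b)\<close>. Since \<open>R - b S\<close> vanishes at \<open>a\<close>, the term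
    \<open>(i, j)\<close> is divisible by the power \<open>i + j\<close> of the linear factor, and
    its coefficient is zero when \<open>i + j < m\<close>.\<close>
  define h where "h = (\<Sum>(i, j)\<in>{..d} \<times> {..e}.
    [:cf T i j:] * [:- a, 1:] ^ i * (R - smult b S) ^ j * S ^ (e - j))"
  have T: "bideg T d e"
    unfolding T_def by (rule bideg_shift[OF D(1)])
  have "poly g x = poly h x" if x: "poly S x \<noteq> 0" for x
  proof -
    define s where "s = poly R x / poly S x"
    have s: "poly R x = s * poly S x"
      using x by (simp add: s_def)
    have pow: "poly S x ^ j * poly S x ^ (e - j) = poly S x ^ e" if "j \<le> e" for j
      using that by (simp flip: power_add)
    have "poly g x = (\<Sum>j\<le>e. poly S x ^ e * (poly (coeff D j) x * s ^ j))"
      unfolding g poly_sum by (intro sum.cong refl) (simp add: s power_mult_distrib algebra_simps flip: pow)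
    also have "\<dots> = poly S x ^ e * ev D x s"
      using D(1) by (subst ev_expand_outer[of D e]) (auto simp: bideg_def sum_distrib_left)
    also have "ev D x s = ev T (x - a) (s - b)"
      by (simp add: T_def)
    also have "poly S x ^ e * \<dots> = poly h x"
    proof -
      have "poly S x ^ e * (cf T i j * (x - a) ^ i * (s - b) ^ j)
          = poly ([:cf T i j:] * [:- a, 1:] ^ i * (R - smult b S) ^ j * S ^ (e - j)) x"
        if "j \<le> e" for i j
      proof -
        have "s * poly S x - b * poly S x = (s - b) * poly S x"
          by (simp add: algebra_simps)
        then show ?thesis
          by (simp add: s power_mult_distrib pow[OF that, symmetric])
      qed
      then show ?thesis
        unfolding ev_expand[OF T] h_def poly_sum sum_distrib_left
        by (intro sum.cong refl) auto
    qed
    finally show ?thesis .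
  qed
  \<comment> \<open>The equality is known only where \<open>S\<close> is nonzero; the factor
    \<open>S\<close> takes care of the remaining \<open>x\<close>.\<close>
  then have "poly ((g - h) * S) x = poly 0 x" for x
    by (cases "poly S x = 0") simp_all
  then have "(g - h) * S = 0"
    by (rule poly_ext)
  then have "g = h"
    using S by simp
  moreover have "[:- a, 1:] ^ m dvd h"
    unfolding h_def
  proof (rule dvd_sum)
    fix k assume "k \<in> {..d} \<times> {..e}"
    obtain i j where k: "k = (i, j)"
      by (cases k)
    have "[:- a, 1:] ^ m dvd [:cf T i j:] * [:- a, 1:] ^ i * (R - smult b S) ^ j * S ^ (e - j)"
    proof (cases "i + j < m")
      case True
      then show ?thesis
        using D(2) by (simp add: vanish_def T_def)
    next
      case False
      have "[:- a, 1:] dvd R - smult b S"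
        using ab by (simp add: poly_eq_0_iff_dvd[symmetric])
      then have "[:- a, 1:] ^ i * [:- a, 1:] ^ j dvd [:- a, 1:] ^ i * (R - smult b S) ^ j"
        by (intro mult_dvd_mono dvd_refl dvd_power_same)
      moreover have "[:- a, 1:] ^ m dvd [:- a, 1:] ^ i * [:- a, 1:] ^ j"
        using False by (simp only: le_imp_power_dvd not_less flip: power_add)
      ultimately have "[:- a, 1:] ^ m dvd [:- a, 1:] ^ i * (R - smult b S) ^ j"
        using dvd_trans by blast
      then have "[:- a, 1:] ^ m dvd [:cf T i j:] * ([:- a, 1:] ^ i * (R - smult b S) ^ j) * S ^ (e - j)"
        by (rule dvd_mult2[OF dvd_mult])
      then show ?thesis
        by (simp only: mult.assoc)
    qed
    then show "[:- a, 1:] ^ m dvd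
        (case k of (i, j) \<Rightarrow> [:cf T i j:] * [:- a, 1:] ^ i * (R - smult b S) ^ j * S ^ (e - j))"
      by (simp only: k prod.case)
  qed
  ultimately show ?thesis
    by simp
qed

text \<open>Six coefficients against five conditions give a curve \<open>E\<close> of bidegree
  \<open>(2, 1)\<close> through \<open>W\<close> and a point off \<open>D\<close>; it is a graph
  \<open>y = R / S\<close>. The restriction of \<open>D\<close> to it has degree at most
  \<open>d + 2 * e\<close> but zeros of total order \<open>4 * m\<close>, the abscissae being
  distinct. So it is zero, although \<open>D\<close> is nonzero at the fifth point.\<close>

lemma four_points_distinct_abscissae:
  fixes W :: "(complex \<times> complex) set" and D :: "complex bpoly"
  assumes W: "card W = 4" "inj_on fst W"
    and unisolvent: "\<And>p. bideg p 1 1 \<Longrightarrow> (\<And>P. P \<in> W \<Longrightarrow> vanish (Suc 0) P p) \<Longrightarrow> p = 0"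
    and D: "bideg D d e" "\<And>P. P \<in> W \<Longrightarrow> vanish m P D" and less: "d + 2 * e < 4 * m"
  shows "D = 0"
proof (rule ccontr)
  assume "D \<noteq> 0"
  have finW: "finite W"
    using W(1) card.infinite by fastforce
  have "D * (\<Prod>P\<in>W. vline (fst P)) \<noteq> 0"
    using \<open>D \<noteq> 0\<close> finW by simp
  then obtain x y where "ev (D * (\<Prod>P\<in>W. vline (fst P))) x y \<noteq> ev 0 x y"
    using ev_eqI by blast
  then have xy: "ev D x y \<noteq> 0" and x: "x \<notin> fst ` W"
    using finW by (auto simp: ev_prod)
  let ?K = "insert (x, y) W" and ?I = "{..2::nat} \<times> {..1::nat}"
  have "finite ?K" "card ?K < card ?I"
    using finW W(1) by (simp_all add: card_insert_if)
  then obtain c where c: "\<forall>i. i \<notin> ?I \<longrightarrow> c i = 0" "\<exists>i. c i \<noteq> 0"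
    and cK: "\<forall>P\<in>?K. ev (box_poly 2 1 c) (fst P) (snd P) = 0"
    using homogeneous_system_solution[of ?I ?K "\<lambda>P c. ev (box_poly 2 1 c) (fst P) (snd P)"]
    by (auto simp: box_poly_add box_poly_smult)
  define E where "E = box_poly 2 1 c"
  have E: "bideg E 2 1" "\<And>P. P \<in> W \<Longrightarrow> vanish (Suc 0) P E" "ev E x y = 0"
    using cK by (simp_all add: E_def bideg_box_poly vanish_1_iff)
  have "E \<noteq> 0"
    unfolding E_def by (rule box_poly_nonzero[OF c])
  define S where "S = coeff E 1"
  define R where "R = - coeff E 0"
  have evE: "ev E s t = poly S s * t - poly R s" for s t
    using E(1) by (subst ev_expand_outer[of E 1]) (auto simp: bideg_def S_def R_def)
  \<comment> \<open>Otherwise \<open>E\<close> contains the vertical line at \<open>x\<close>, which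
    misses \<open>W\<close>, and the rest is a curve of bidegree \<open>(1, 1)\<close> through
    \<open>W\<close>.\<close>
  have Sx: "poly S x \<noteq> 0"
  proof
    assume "poly S x = 0"
    then have "ev E x t = 0" for t
      using E(3) evE by simp
    then have "poly (swp E) [:x:] = 0"
      by (intro poly_ext) (simp add: poly_vline)
    then obtain q where q: "E = vline x * q"
      by (rule vline_dvd)
    then have "q \<noteq> 0"
      using \<open>E \<noteq> 0\<close> by auto
    then have "bideg q 1 1"
      using bideg_vline_mult(2)[of x q 2 1] E(1) q by simp
    moreover have "vanish (Suc 0) P q" if "P \<in> W" for P
    proof (rule vanish_cancel)
      show "ev (vline x) (fst P) (snd P) \<noteq> 0"
        using x that by auto
    qed (use E(2)[OF that] q in simp)
    ultimately show False
      using unisolvent \<open>q \<noteq> 0\<close> by blast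
  qed
  define g where "g = (\<Sum>j\<le>e. coeff D j * R ^ j * S ^ (e - j))"
  have "(\<Prod>P\<in>W. [:- fst P, 1:] ^ m) dvd g"
  proof (rule prod_linear_power_dvd[OF finW W(2)])
    fix P assume P: "P \<in> W"
    show "[:- fst P, 1:] ^ m dvd g"
    proof (rule restriction_to_graph_dvd[OF D(1) _ _ _ g_def])
      show "vanish m (fst P, snd P) D" "S \<noteq> 0"
        using D(2)[OF P] Sx by auto
      show "poly R (fst P) = snd P * poly S (fst P)"
        using E(2)[OF P] by (simp add: vanish_1_iff evE mult.commute)
    qed
  qed
  then have "degree (\<Prod>P\<in>W. [:- fst P, 1:] ^ m) \<le> degree g" if "g \<noteq> 0"
    using that by (rule dvd_imp_degree_le)
  then have "4 * m \<le> degree g" if "g \<noteq> 0"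
    using that W(1) by (simp add: degree_prod_linear_power)
  moreover have "degree g \<le> d + 2 * e"
    unfolding g_def
  proof (rule degree_sum_le)
    fix j assume j: "j \<in> {..e}"
    have dE: "degree (coeff E i) \<le> 2" for i
      using E(1) by (intro degree_le) (auto simp: bideg_cf cf_def not_le[symmetric])
    have dD: "degree (coeff D j) \<le> d"
      using D(1) by (intro degree_le) (auto simp: bideg_cf cf_def not_le[symmetric])
    have "degree (coeff D j * R ^ j * S ^ (e - j)) \<le> degree (coeff D j) + degree (R ^ j) + degree (S ^ (e - j))"
      by (meson degree_mult_le add_mono le_refl le_trans)
    also have "\<dots> \<le> d + degree R * j + degree S * (e - j)"
      using dD by (intro add_mono degree_power_le)
    also have "\<dots> \<le> d + 2 * j + 2 * (e - j)"
      using dE by (intro add_mono mult_le_mono) (auto simp: R_def S_def)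
    finally show "degree (coeff D j * R ^ j * S ^ (e - j)) \<le> d + 2 * e"
      using j by simp
  qed simp
  ultimately have "g = 0"
    using less by force
  moreover have "poly g x = poly S x ^ e * ev D x y"
  proof -
    have R: "poly R x = y * poly S x"
      using E(3) evE by (simp add: mult.commute)
    have pow: "poly S x ^ j * poly S x ^ (e - j) = poly S x ^ e" if "j \<le> e" for j
      using that by (simp flip: power_add)
    have "poly g x = (\<Sum>j\<le>e. poly S x ^ e * (poly (coeff D j) x * y ^ j))"
      unfolding g_def poly_sum by (intro sum.cong refl) (simp add: R power_mult_distrib algebra_simps flip: pow)
    also have "\<dots> = poly S x ^ e * ev D x y"
      using D(1) by (subst ev_expand_outer[of D e]) (auto simp: bideg_def sum_distrib_left)
    finally show ?thesis .
  qed
  ultimately show False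
    using Sx xy by simp
qed

text \<open>Among the four points of \<open>W\<close> two share an abscissa and two an ordinate.
  These pairs are shown to meet in a corner \<open>(x0, w)\<close>, with further points
  \<open>(x0, y)\<close> and \<open>(x1, w)\<close>. The position of the fourth point
  \<open>(s, t)\<close> then gives a path with two vertical edges, one with two horizontal edges, an
  L-shape with a separate point, or a full two by two grid.\<close>

proposition multiplicity_6_implies_grid:
  fixes Z :: "(complex \<times> complex) set" and D :: "complex bpoly"
  assumes "finite Z"
    and Z: "\<And>p. bideg p 1 1 \<Longrightarrow> (\<And>P. P \<in> Z \<Longrightarrow> vanish (Suc 0) P p) \<Longrightarrow> p = 0"
    and D: "D \<noteq> 0" "bideg D 7 7" "\<And>P. P \<in> Z \<Longrightarrow> vanish 6 P D"
  shows "\<exists>x0 x1 y0 y1. Z \<subseteq> {x0, x1} \<times> {y0, y1}"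
proof (rule ccontr)
  assume no_grid: "\<not> ?thesis"
  obtain W where "W \<subseteq> Z" "card W = Suc 1 * Suc 1"
    and unisolvent: "\<And>p. bideg p 1 1 \<Longrightarrow> (\<And>P. P \<in> W \<Longrightarrow> vanish (Suc 0) P p) \<Longrightarrow> p = 0"
    using minimal_unisolvent_subset[OF \<open>finite Z\<close> Z] by blast
  then have W: "W \<subseteq> Z" "card W = 4"
    by simp_all
  have finW: "finite W"
    using W \<open>finite Z\<close> finite_subset by blast
  have "admits 7 7 [(P, 6), (Q, 6), (R, 6), (S, 6)]" if "P \<in> Z" "Q \<in> Z" "R \<in> Z" "S \<in> Z" for P Q R S
    unfolding admits_def using D that by (intro exI[of _ D]) auto
  note adm = this this[THEN admits_swap]
  have path_v: False
    if "(x0, y0) \<in> Z" "(x0, y1) \<in> Z" "(x1, y0) \<in> Z" "(x1, y2) \<in> Z"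
      "x0 \<noteq> x1" "y0 \<noteq> y1" "y0 \<noteq> y2" "y1 \<noteq> y2" for x0 x1 y0 y1 y2
    using adm(1)[OF that(1-4)] path4_not_admits_7[OF that(5-8)] by simp
  have path_h: False
    if "(x0, y0) \<in> Z" "(x1, y0) \<in> Z" "(x0, y1) \<in> Z" "(x2, y1) \<in> Z"
      "y0 \<noteq> y1" "x0 \<noteq> x1" "x0 \<noteq> x2" "x1 \<noteq> x2" for x0 x1 x2 y0 y1
    using adm(2)[OF that(1-4)] path4_not_admits_7[OF that(5-8)] by simp
  have path_edge: False
    if "(x0, y0) \<in> Z" "(x0, y1) \<in> Z" "(x1, y1) \<in> Z" "(x2, y2) \<in> Z"
      "x0 \<noteq> x1" "x0 \<noteq> x2" "x1 \<noteq> x2" "y0 \<noteq> y1" "y0 \<noteq> y2" "y1 \<noteq> y2" for x0 x1 x2 y0 y1 y2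
    using adm(1)[OF that(1-4)] path3_edge_not_admits_7[OF that(5-10)] by simp
  have not_covered: "\<exists>s t. (s, t) \<in> W \<and> s \<noteq> c \<and> t \<noteq> b" for c b
  proof (rule ccontr)
    assume "\<not> ?thesis"
    then have "vanish (Suc 0) P (vline c * hline b)" if "P \<in> W" for P
      using that by (cases P) (auto simp: vanish_1_iff)
    moreover have "bideg (vline c * hline b) 1 1"
      using bideg_mult[OF bideg_vline bideg_hline] by simp
    ultimately show False
      using unisolvent[of "vline c * hline b"] by simp
  qed
  \<comment> \<open>By assumption \<open>Z\<close> has a point outside the grid; together with three
    of the grid points it forms one of the three excluded configurations.\<close>
  have grid: False if "(x0, y0) \<in> Z" "(x0, y1) \<in> Z" "(x1, y0) \<in> Z" "(x1, y1) \<in> Z" "x0 \<noteq> x1" "y0 \<noteq> y1"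
    for x0 x1 y0 y1
  proof -
    obtain x2 y2 where z: "(x2, y2) \<in> Z" "(x2, y2) \<notin> {x0, x1} \<times> {y0, y1}"
      using no_grid by (metis subrelI)
    then consider "x2 = x0" "y2 \<noteq> y0" "y2 \<noteq> y1" | "x2 = x1" "y2 \<noteq> y0" "y2 \<noteq> y1"
      | "y2 = y0" "x2 \<noteq> x0" "x2 \<noteq> x1" | "y2 = y1" "x2 \<noteq> x0" "x2 \<noteq> x1"
      | "x2 \<noteq> x0" "x2 \<noteq> x1" "y2 \<noteq> y0" "y2 \<noteq> y1"
      by blast
    then show False
    proof cases
      case 1
      then show False using path_v[of x0 y0 y2 x1 y1] that z by auto
    next
      case 2
      then show False using path_v[of x1 y0 y2 x0 y1] that z by auto
    next
      case 3
      then show False using path_h[of x0 y0 x2 y1 x1] that z by auto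
    next
      case 4
      then show False using path_h[of x0 y1 x2 y0 x1] that z by auto
    next
      case 5
      then show False using path_edge[of x0 y0 y1 x1 x2 y2] that z by auto
    qed
  qed
  \<comment> \<open>The numerical condition is \<open>7 + 2 * 7 < 4 * 6\<close>.\<close>
  have "\<not> inj_on fst W"
    using four_points_distinct_abscissae[OF W(2) _ unisolvent D(2), of 6] D W(1) by auto
  then obtain x0 y0 y1 where v: "(x0, y0) \<in> W" "(x0, y1) \<in> W" "y0 \<noteq> y1"
    unfolding inj_on_def by (metis prod.collapse)
  have "\<not> inj_on snd W"
  proof
    assume "inj_on snd W"
    then have "inj_on fst (prod.swap ` W)"
      by (auto simp: inj_on_def)
    moreover have "card (prod.swap ` W) = 4"
      using W(2) by (simp add: card_image)
    moreover have "p = 0" if "bideg p 1 1" "\<And>P. P \<in> prod.swap ` W \<Longrightarrow> vanish (Suc 0) P p" for p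
      using unisolvent[of "swp p"] that by (auto simp: vanish_1_iff)
    moreover have "vanish 6 P (swp D)" if "P \<in> prod.swap ` W" for P
      using that D(3) W(1) by (auto simp: vanish_swp)
    ultimately have "swp D = 0"
      using four_points_distinct_abscissae[of "prod.swap ` W" "swp D" 7 7 6] D(2) by simp
    then show False
      using D(1) by simp
  qed
  then obtain u0 u1 w where h: "(u0, w) \<in> W" "(u1, w) \<in> W" "u0 \<noteq> u1"
    unfolding inj_on_def by (metis prod.collapse)
  \<comment> \<open>If the vertical and the horizontal pair were disjoint, then together with
    \<open>(s, t)\<close>, which lies on neither of their lines, they would be five points of
    \<open>W\<close>. The same count shows that the corner belongs to the horizontal pair.\<close>
  have small: "\<not> (A \<subseteq> W \<and> card A = 5)" for A
    using card_mono[OF finW, of A] W(2) by auto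
  obtain s t where st: "(s, t) \<in> W" "s \<noteq> x0" "t \<noteq> w"
    using not_covered by blast
  have w: "w = y0 \<or> w = y1"
  proof (rule ccontr)
    assume "\<not> ?thesis"
    then show False
      using small[of "{(x0, y0), (x0, y1), (u0, w), (u1, w), (s, t)}"] v h st by auto
  qed
  define y where "y = (if w = y0 then y1 else y0)"
  have y: "(x0, w) \<in> W" "(x0, y) \<in> W" "y \<noteq> w"
    using v w by (auto simp: y_def)
  have "u0 = x0 \<or> u1 = x0"
  proof (rule ccontr)
    assume "\<not> ?thesis"
    then show False
      using small[of "{(x0, w), (x0, y), (u0, w), (u1, w), (s, t)}"] y h st by auto
  qed
  define x1 where "x1 = (if u0 = x0 then u1 else u0)"
  have x1: "(x1, w) \<in> W" "x1 \<noteq> x0"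
    using h \<open>u0 = x0 \<or> u1 = x0\<close> by (auto simp: x1_def)
  have Z': "(x0, w) \<in> Z" "(x0, y) \<in> Z" "(x1, w) \<in> Z" "(s, t) \<in> Z"
    using y x1 st W(1) by auto
  show False
    using Z' grid[of x0 w y x1] path_v[of x0 w y x1 t] path_h[of x0 w x1 y s]
      path_edge[of x0 y w x1 s t] y(3) x1(2) st(2,3) by (cases "s = x1"; cases "t = y") auto
qed

section \<open>Forms and their values\<close>

definition monomial_value :: "complex \<times> complex \<Rightarrow> complex \<times> complex \<Rightarrow> (var \<Rightarrow>\<^sub>0 nat) \<Rightarrow> complex" where
  "monomial_value x y s = fst x ^ Poly_Mapping.lookup s X0 * snd x ^ Poly_Mapping.lookup s X1 *
     fst y ^ Poly_Mapping.lookup s Y0 * snd y ^ Poly_Mapping.lookup s Y1"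

lemma monomial_value_add: "monomial_value x y (s + t) = monomial_value x y s * monomial_value x y t"
  by (simp add: monomial_value_def lookup_add power_add)

lemma eval_mono: "eval F x y = (\<Sum>s\<in>Poly_Mapping.keys F. Poly_Mapping.lookup F s * monomial_value x y s)"
  by (simp add: eval_def monomial_value_def)

lemma eval_superset:
  assumes "finite A" "Poly_Mapping.keys F \<subseteq> A"
  shows "eval F x y = (\<Sum>s\<in>A. Poly_Mapping.lookup F s * monomial_value x y s)"
  unfolding eval_mono using assms
  by (intro sum.mono_neutral_left) (auto simp: in_keys_iff)

lemma eval_add [simp]: "eval (F + G) x y = eval F x y + eval G x y"
proof -
  let ?A = "Poly_Mapping.keys F \<union> Poly_Mapping.keys G"
  have "eval (F + G) x y = (\<Sum>s\<in>?A. Poly_Mapping.lookup (F + G) s * monomial_value x y s)"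
    by (rule eval_superset) (auto simp: keys_add)
  also have "\<dots> = eval F x y + eval G x y"
    by (simp add: eval_superset[of ?A] lookup_add distrib_right sum.distrib)
  finally show ?thesis .
qed

lemma eval_0 [simp]: "eval 0 x y = 0"
  by (simp add: eval_def)

lemma eval_sum: "eval (sum f A) x y = (\<Sum>a\<in>A. eval (f a) x y)"
  by (induction A rule: infinite_finite_induct) simp_all

lemma eval_single [simp]: "eval (Poly_Mapping.single s c) x y = c * monomial_value x y s"
  by (cases "c = 0") (simp_all add: eval_mono)

lemma sum_single_lookup:
  "(\<Sum>s\<in>Poly_Mapping.keys F. Poly_Mapping.single s (Poly_Mapping.lookup F s)) = F"
  by (rule poly_mapping_eqI)
    (auto simp: lookup_sum lookup_single when_def in_keys_iff)

lemma eval_mult [simp]: "eval (F * G) x y = eval F x y * eval G x y"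
proof -
  let ?f = "\<lambda>s t. Poly_Mapping.single s (Poly_Mapping.lookup F s) * Poly_Mapping.single t (Poly_Mapping.lookup G t)"
  have "F * G = (\<Sum>s\<in>Poly_Mapping.keys F. \<Sum>t\<in>Poly_Mapping.keys G. ?f s t)"
    by (subst (1) sum_single_lookup[of F, symmetric], subst (1) sum_single_lookup[of G, symmetric])
      (simp add: sum_product)
  then have "eval (F * G) x y = (\<Sum>s\<in>Poly_Mapping.keys F. \<Sum>t\<in>Poly_Mapping.keys G. eval (?f s t) x y)"
    by (simp add: eval_sum)
  also have "\<dots> = eval F x y * eval G x y"
    by (simp add: eval_mono[of F] eval_mono[of G] sum_product mult_single monomial_value_add algebra_simps)
  finally show ?thesis .
qed

lemma eval_Const [simp]: "eval (Const c) x y = c"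
  by (simp add: Const_def monomial_value_def)

lemma eval_Var [simp]:
  "eval (Var X0) x y = fst x" "eval (Var X1) x y = snd x"
  "eval (Var Y0) x y = fst y" "eval (Var Y1) x y = snd y"
  by (simp_all add: Var_def monomial_value_def lookup_single)

lemma Const_0 [simp]: "Const 0 = 0"
  by (simp add: Const_def)

lemma Const_1 [simp]: "Const 1 = 1"
  by (simp add: Const_def)

lemma Const_add: "Const (a + b) = Const a + Const b"
  by (simp add: Const_def single_add)

lemma Const_mult: "Const (a * b) = Const a * Const b"
  by (simp add: Const_def mult_single)

lemma Const_power: "Const (a ^ n) = Const a ^ n"
  by (induction n) (simp_all add: Const_mult)

lemma eval_uminus [simp]: "eval (- F) x y = - eval F x y"
proof -
  have "eval (F + - F) x y = 0"
    by simp
  then show ?thesis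
    unfolding eval_add by (simp add: add_eq_0_iff)
qed

lemma eval_diff [simp]: "eval (F - G) x y = eval F x y - eval G x y"
  using eval_add[of F "- G"] by simp

lemma eval_1 [simp]: "eval 1 x y = 1"
  using eval_Const[of 1] by simp

lemma eval_power [simp]: "eval (F ^ n) x y = eval F x y ^ n"
  by (induction n) simp_all

lemma eval_prod: "eval (prod f A) x y = (\<Prod>a\<in>A. eval (f a) x y)"
  by (induction A rule: infinite_finite_induct) simp_all

lemma form_lookup: "form_of_bidegree k l F \<longleftrightarrow> (\<forall>s. Poly_Mapping.lookup F s \<noteq> 0 \<longrightarrow>
    Poly_Mapping.lookup s X0 + Poly_Mapping.lookup s X1 = k \<and>
    Poly_Mapping.lookup s Y0 + Poly_Mapping.lookup s Y1 = l)"
  by (simp add: form_of_bidegree_def in_keys_iff Ball_def)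

lemma form_add: "form_of_bidegree k l F \<Longrightarrow> form_of_bidegree k l G \<Longrightarrow> form_of_bidegree k l (F + G)"
  unfolding form_lookup lookup_add by (metis add.right_neutral)

lemma form_uminus: "form_of_bidegree k l F \<Longrightarrow> form_of_bidegree k l (- F)"
  by (simp add: form_lookup)

lemma form_diff: "form_of_bidegree k l F \<Longrightarrow> form_of_bidegree k l G \<Longrightarrow> form_of_bidegree k l (F - G)"
  using form_add[of k l F "- G"] form_uminus by simp

lemma form_0 [simp]: "form_of_bidegree k l 0"
  by (simp add: form_lookup)

lemma form_sum: "(\<And>a. a \<in> A \<Longrightarrow> form_of_bidegree k l (f a)) \<Longrightarrow> form_of_bidegree k l (sum f A)"
  by (induction A rule: infinite_finite_induct) (auto intro: form_add)

lemma form_mult: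
  assumes "form_of_bidegree k l F" "form_of_bidegree k' l' G"
  shows "form_of_bidegree (k + k') (l + l') (F * G)"
  unfolding form_of_bidegree_def
proof
  fix s assume "s \<in> Poly_Mapping.keys (F * G)"
  then obtain a b where "s = a + b" "a \<in> Poly_Mapping.keys F" "b \<in> Poly_Mapping.keys G"
    using keys_mult by blast
  then have "s = a + b"
    "Poly_Mapping.lookup a X0 + Poly_Mapping.lookup a X1 = k \<and>
     Poly_Mapping.lookup a Y0 + Poly_Mapping.lookup a Y1 = l"
    "Poly_Mapping.lookup b X0 + Poly_Mapping.lookup b X1 = k' \<and>
     Poly_Mapping.lookup b Y0 + Poly_Mapping.lookup b Y1 = l'"
    using assms by (simp_all add: form_of_bidegree_def)
  then show "Poly_Mapping.lookup s X0 + Poly_Mapping.lookup s X1 = k + k' \<and>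
      Poly_Mapping.lookup s Y0 + Poly_Mapping.lookup s Y1 = l + l'"
    by (auto simp: lookup_add)
qed

lemma form_Const: "form_of_bidegree 0 0 (Const c)"
  by (auto simp: form_of_bidegree_def Const_def split: if_splits)

lemma form_1: "form_of_bidegree 0 0 1"
  using form_Const[of 1] by simp

lemma form_Const_mult: "form_of_bidegree k l F \<Longrightarrow> form_of_bidegree k l (Const c * F)"
  using form_mult[OF form_Const] by simp

lemma form_power: "form_of_bidegree k l F \<Longrightarrow> form_of_bidegree (n * k) (n * l) (F ^ n)"
  by (induction n) (use form_1 form_mult in \<open>auto simp: form_1 dest: form_mult\<close>)

lemma form_prod:
  "(\<And>a. a \<in> A \<Longrightarrow> form_of_bidegree k l (f a)) \<Longrightarrow> form_of_bidegree (card A * k) (card A * l) (prod f A)"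
  by (induction A rule: infinite_finite_induct) (use form_mult in \<open>auto simp: form_1\<close>)

lemma form_Var:
  "form_of_bidegree 1 0 (Var X0)" "form_of_bidegree 1 0 (Var X1)"
  "form_of_bidegree 0 1 (Var Y0)" "form_of_bidegree 0 1 (Var Y1)"
  by (auto simp: form_of_bidegree_def Var_def lookup_single)

section \<open>Dehomogenization\<close>

text \<open>The affine chart \<open>x \<mapsto> [x : 1 + t x]\<close>; its point at infinity is \<open>[1 : t]\<close>.\<close>

definition dehom :: "complex \<Rightarrow> coord_ring \<Rightarrow> complex bpoly" where
  "dehom t F = (\<Sum>s\<in>Poly_Mapping.keys F. smult [:Poly_Mapping.lookup F s:]
     (vline 0 ^ Poly_Mapping.lookup s X0 * [:[:1, t:]:] ^ Poly_Mapping.lookup s X1 *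
      (hline 0 ^ Poly_Mapping.lookup s Y0 * swp [:[:1, t:]:] ^ Poly_Mapping.lookup s Y1)))"

lemma ev_dehom [simp]: "ev (dehom t F) x y = eval F (x, 1 + t * x) (y, 1 + t * y)"
proof -
  have "ev [:[:1, t:]:] x y = 1 + t * x" for x y
    by (simp add: ev_def mult.commute)
  then show ?thesis
    by (simp add: dehom_def ev_sum eval_mono monomial_value_def mult.assoc)
qed

lemma dehom_add [simp]: "dehom t (F + G) = dehom t F + dehom t G"
  by (rule ev_eqI) simp

lemma dehom_mult [simp]: "dehom t (F * G) = dehom t F * dehom t G"
  by (rule ev_eqI) simp

lemma dehom_0 [simp]: "dehom t 0 = 0"
  by (rule ev_eqI) simp

lemma dehom_power [simp]: "dehom t (F ^ n) = dehom t F ^ n"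
  by (rule ev_eqI) simp

lemma dehom_prod: "dehom t (prod f A) = (\<Prod>a\<in>A. dehom t (f a))"
  by (rule ev_eqI) (simp add: eval_prod ev_prod)

lemma bideg_dehom:
  assumes "form_of_bidegree k l F"
  shows "bideg (dehom t F) k l"
  unfolding dehom_def
proof (rule bideg_sum)
  fix s assume s: "s \<in> Poly_Mapping.keys F"
  have "swp [:[:1, t:]:] = [:1, [:t:]:]"
    by (rule ev_eqI, subst ev_swp) (simp add: ev_def mult.commute)
  then have lin: "bideg [:[:1, t:]:] 1 0"
    by (simp add: bideg_def)
  then have lin': "bideg (swp [:[:1, t:]:]) 0 1"
    by (simp only: bideg_swp)
  let ?a = "Poly_Mapping.lookup s X0" and ?b = "Poly_Mapping.lookup s X1"
    and ?c = "Poly_Mapping.lookup s Y0" and ?d = "Poly_Mapping.lookup s Y1"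
  have "bideg (vline 0 ^ ?a * [:[:1, t:]:] ^ ?b * (hline 0 ^ ?c * swp [:[:1, t:]:] ^ ?d))
      (?a * 1 + ?b * 1 + (?c * 0 + ?d * 0)) (?a * 0 + ?b * 0 + (?c * 1 + ?d * 1))"
    by (intro bideg_mult bideg_power bideg_vline bideg_hline lin lin')
  then show "bideg (smult [:Poly_Mapping.lookup F s:]
      (vline 0 ^ ?a * [:[:1, t:]:] ^ ?b * (hline 0 ^ ?c * swp [:[:1, t:]:] ^ ?d))) k l"
    using assms s by (intro bideg_smult) (auto simp: form_of_bidegree_def)
qed

lemma eval_homogeneous:
  assumes "form_of_bidegree k l F"
  shows "eval F (c * x0, c * x1) (d * y0, d * y1) = c ^ k * d ^ l * eval F (x0, x1) (y0, y1)"
  unfolding eval_def sum_distrib_left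
proof (intro sum.cong refl)
  fix s assume "s \<in> Poly_Mapping.keys F"
  then have k: "k = Poly_Mapping.lookup s X0 + Poly_Mapping.lookup s X1"
    and l: "l = Poly_Mapping.lookup s Y0 + Poly_Mapping.lookup s Y1"
    using assms by (auto simp: form_of_bidegree_def)
  show "Poly_Mapping.lookup F s *
      (fst (c * x0, c * x1) ^ Poly_Mapping.lookup s X0 * snd (c * x0, c * x1) ^ Poly_Mapping.lookup s X1 *
       fst (d * y0, d * y1) ^ Poly_Mapping.lookup s Y0 * snd (d * y0, d * y1) ^ Poly_Mapping.lookup s Y1) =
    c ^ k * d ^ l * (Poly_Mapping.lookup F s *
      (fst (x0, x1) ^ Poly_Mapping.lookup s X0 * snd (x0, x1) ^ Poly_Mapping.lookup s X1 *
       fst (y0, y1) ^ Poly_Mapping.lookup s Y0 * snd (y0, y1) ^ Poly_Mapping.lookup s Y1))"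
    by (simp add: k l power_add power_mult_distrib)
qed

text \<open>The values at \<open>(x, 1)\<close>, \<open>(y, 1)\<close> are, up to nonzero factors,
  values in the chart whenever \<open>1 - t x\<close> and \<open>1 - t y\<close> are nonzero. This
  reduces the claim to \<open>t = 0\<close>. There the coefficients are those of \<open>F\<close>,
  because the bidegree recovers the exponents of \<open>X1\<close> and \<open>Y1\<close> from those
  of \<open>X0\<close> and \<open>Y0\<close>.\<close>

lemma dehom_nonzero:
  assumes F: "form_of_bidegree k l F" "F \<noteq> 0"
  shows "dehom t F \<noteq> 0"
proof
  assume 0: "dehom t F = 0"
  have "eval F (x, 1) (y, 1) = 0" if "1 - t * x \<noteq> 0" "1 - t * y \<noteq> 0" for x y
  proof -
    define c where "c = inverse (1 - t * x)"
    define d where "d = inverse (1 - t * y)"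
    have c: "c * (1 - t * x) = 1" "c \<noteq> 0" and d: "d * (1 - t * y) = 1" "d \<noteq> 0"
      using that by (simp_all add: c_def d_def)
    have "c * 1 = 1 + t * (c * x)" "d * 1 = 1 + t * (d * y)"
      using c(1) d(1) by (simp_all add: algebra_simps)
    moreover have "eval F (c * x, 1 + t * (c * x)) (d * y, 1 + t * (d * y)) = 0"
      using arg_cong[OF 0, of "\<lambda>p. ev p (c * x) (d * y)"] by simp
    ultimately have "eval F (c * x, c * 1) (d * y, d * 1) = 0"
      by simp
    then show ?thesis
      using c(2) d(2) eval_homogeneous[OF F(1), of c x 1 d y 1] by simp
  qed
  note chart = this
  define w where "w = [:[:1, - t:]:]"
  have "ev w x y = 1 - t * x" for x y
    by (simp add: w_def ev_def mult.commute)
  then have "ev (dehom 0 F * (w * swp w)) x y = ev 0 x y" for x y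
    using chart[of x y] by auto
  then have "dehom 0 F * (w * swp w) = 0"
    by (rule ev_eqI)
  then have dehom0: "dehom 0 F = 0"
    by (simp add: w_def)
  obtain s where s: "s \<in> Poly_Mapping.keys F"
    using F(2) by fastforce
  have "cf (dehom 0 F) (Poly_Mapping.lookup s X0) (Poly_Mapping.lookup s Y0)
    = (\<Sum>s'\<in>Poly_Mapping.keys F. if s' = s then Poly_Mapping.lookup F s else 0)"
    unfolding dehom_def cf_sum
  proof (intro sum.cong refl)
    fix s' assume s': "s' \<in> Poly_Mapping.keys F"
    have one: "[:[:1:]:] = (1 :: complex bpoly)"
      by (simp add: one_pCons)
    have swp_one: "swp 1 = (1 :: complex bpoly)"
      by (rule ev_eqI) simp
    have "vline 0 ^ i * hline 0 ^ j = monom (monom (1 :: complex) i) j" for i j :: nat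
      by (rule ev_eqI) (simp, simp add: ev_def poly_monom)
    moreover have "s' = s" if "Poly_Mapping.lookup s' X0 = Poly_Mapping.lookup s X0"
      "Poly_Mapping.lookup s' Y0 = Poly_Mapping.lookup s Y0"
    proof (rule poly_mapping_eqI)
      fix v
      show "Poly_Mapping.lookup s' v = Poly_Mapping.lookup s v"
        using F(1)[unfolded form_of_bidegree_def, rule_format, OF s]
          F(1)[unfolded form_of_bidegree_def, rule_format, OF s'] that by (cases v) auto
    qed
    ultimately show "cf (smult [:Poly_Mapping.lookup F s':]
        (vline 0 ^ Poly_Mapping.lookup s' X0 * [:[:1, 0:]:] ^ Poly_Mapping.lookup s' X1 *
         (hline 0 ^ Poly_Mapping.lookup s' Y0 * swp [:[:1, 0:]:] ^ Poly_Mapping.lookup s' Y1)))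
        (Poly_Mapping.lookup s X0) (Poly_Mapping.lookup s Y0)
      = (if s' = s then Poly_Mapping.lookup F s else 0)"
      by (auto simp: cf_smult one swp_one cf_monom)
  qed
  also have "\<dots> = Poly_Mapping.lookup F s"
    using s by simp
  finally show False
    using s dehom0 by (simp add: in_keys_iff)
qed

section \<open>Powers of ideals\<close>

lemma ideal_gen_subsetI:
  assumes "S \<subseteq> T" "0 \<in> T" "\<And>x y. x \<in> T \<Longrightarrow> y \<in> T \<Longrightarrow> x + y \<in> T" "\<And>c x. x \<in> T \<Longrightarrow> c * x \<in> T"
  shows "ideal_gen S \<subseteq> T"
  using assms(1) by (rule module.span_minimal[OF module_mult])
    (use assms(2-) in \<open>auto simp: module.subspace_def[OF module_mult]\<close>)

lemmas ideal_gen_base = module.span_base[OF module_mult]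
  and ideal_gen_0 = module.span_zero[OF module_mult]
  and ideal_gen_add = module.span_add[OF module_mult]
  and ideal_gen_sum = module.span_sum[OF module_mult]
  and ideal_gen_mult = module.span_scale[OF module_mult]

lemma ideal_power_mult_left: "g \<in> ideal_power J m \<Longrightarrow> f * g \<in> ideal_power J m"
  by (cases m) (simp_all add: ideal_gen_mult)

lemma ideal_power_mult_right: "g \<in> ideal_power J m \<Longrightarrow> g * f \<in> ideal_power J m"
  by (metis ideal_power_mult_left mult.commute)

lemma ideal_power_Suc_mult: "f \<in> J \<Longrightarrow> g \<in> ideal_power J m \<Longrightarrow> f * g \<in> ideal_power J (Suc m)"
  by (auto intro: ideal_gen_base)

lemma ideal_power_power_mult: "f \<in> J \<Longrightarrow> g \<in> ideal_power J m \<Longrightarrow> f ^ n * g \<in> ideal_power J (n + m)"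
  by (induction n) (auto simp: mult.assoc simp del: ideal_power.simps(2) intro: ideal_power_Suc_mult)

lemma ideal_power_Suc_subset: "ideal_power J (Suc m) \<subseteq> ideal_power J m"
proof (cases m)
  case (Suc n)
  show ?thesis
    unfolding ideal_power.simps(2)[of J m]
  proof (rule ideal_gen_subsetI)
    show "{f * g |f g. f \<in> J \<and> g \<in> ideal_power J m} \<subseteq> ideal_power J m"
      using ideal_power_mult_left by blast
  qed (use Suc in \<open>auto intro: ideal_gen_0 ideal_gen_add ideal_gen_mult\<close>)
qed simp

lemma ideal_power_antimono: "n \<le> m \<Longrightarrow> ideal_power J m \<subseteq> ideal_power J n"
  by (induction m rule: dec_induct) (use ideal_power_Suc_subset in blast)+

lemma ideal_power_1_ideal_gen: "ideal_power (ideal_gen S) 1 = ideal_gen S"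
proof
  have "{f * g |f g. f \<in> ideal_gen S \<and> g \<in> UNIV} \<subseteq> ideal_gen S"
  proof clarify
    fix f g assume "f \<in> ideal_gen S"
    then have "g * f \<in> ideal_gen S"
      by (rule ideal_gen_mult)
    then show "f * g \<in> ideal_gen S"
      by (simp only: mult.commute)
  qed
  then have "ideal_gen {f * g |f g. f \<in> ideal_gen S \<and> g \<in> UNIV} \<subseteq> ideal_gen S"
    by (rule ideal_gen_subsetI) (auto intro: ideal_gen_0 ideal_gen_add ideal_gen_mult)
  then show "ideal_power (ideal_gen S) 1 \<subseteq> ideal_gen S"
    by simp
  show "ideal_gen S \<subseteq> ideal_power (ideal_gen S) 1"
  proof
    fix f assume "f \<in> ideal_gen S"
    then have "f * 1 \<in> ideal_power (ideal_gen S) (Suc 0)"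
      by (rule ideal_power_Suc_mult) simp
    then show "f \<in> ideal_power (ideal_gen S) 1"
      by (simp del: ideal_power.simps(2))
  qed
qed

section \<open>Points of the affine chart\<close>

definition chart :: "complex \<Rightarrow> complex \<times> complex \<Rightarrow> point" where
  "chart t P = (hcoords (fst P) (1 + t * fst P), hcoords (snd P) (1 + t * snd P))"

text \<open>Equation of the point \<open>[r : 1 + t r]\<close>. In the chart it becomes
  \<open>(1 + t r) x - r (1 + t x) = x - r\<close>.\<close>

definition xform :: "complex \<Rightarrow> complex \<Rightarrow> coord_ring" where
  "xform t r = Const (1 + t * r) * Var X0 - Const r * Var X1"

definition yform :: "complex \<Rightarrow> complex \<Rightarrow> coord_ring" where
  "yform t s = Const (1 + t * s) * Var Y0 - Const s * Var Y1"

lemma point_ideal_chart: "point_ideal (chart t P) = ideal_gen {xform t (fst P), yform t (snd P)}"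
  unfolding chart_def xform_def yform_def by (rule point_ideal_hcoords) auto

lemma xform_mem: "fst P = r \<Longrightarrow> xform t r \<in> point_ideal (chart t P)"
  and yform_mem: "snd P = s \<Longrightarrow> yform t s \<in> point_ideal (chart t P)"
  by (auto simp: point_ideal_chart intro: ideal_gen_base)

lemma form_xform: "form_of_bidegree 1 0 (xform t r)" and form_yform: "form_of_bidegree 0 1 (yform t s)"
  unfolding xform_def yform_def by (intro form_diff form_Const_mult form_Var)+

lemma dehom_xform [simp]: "dehom t (xform t r) = vline r"
  and dehom_yform [simp]: "dehom t (yform t s) = hline s"
  by (rule ev_eqI; simp add: xform_def yform_def algebra_simps)+

lemma hcoords_scale:
  assumes "(a, b) \<noteq> (0, 0)" "c \<noteq> 0"
  shows "hcoords a b = hcoords (c * a) (c * b)"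
proof -
  have "proj_rel (a, b) (c * a, c * b)"
    using assms by (auto simp: proj_rel_def)
  then show ?thesis
    unfolding hcoords_def by (rule Quotient3_rel_abs[OF Quotient3_proj_line])
qed

lemma proj_line_hcoords: "\<exists>a b. (a, b) \<noteq> (0, 0) \<and> L = hcoords a b"
proof (induction L rule: proj_line.abs_induct)
  case (1 u)
  then have "(fst u, snd u) \<noteq> (0, 0) \<and> abs_proj_line u = hcoords (fst u) (snd u)"
    by (simp add: proj_rel_def hcoords_def)
  then show ?case
    by blast
qed

lemma hcoords_chart:
  assumes "(a, b) \<noteq> (0, 0)" "b - t * a \<noteq> 0"
  shows "\<exists>r. hcoords a b = hcoords r (1 + t * r)"
proof (intro exI)
  have "inverse (b - t * a) * b = 1 + t * (inverse (b - t * a) * a)"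
    using assms(2) by (simp add: field_simps)
  then show "hcoords a b = hcoords (inverse (b - t * a) * a) (1 + t * (inverse (b - t * a) * a))"
    using hcoords_scale[OF assms(1), of "inverse (b - t * a)"] assms(2) by simp
qed

lemma finite_set_in_chart:
  assumes "finite Z"
  obtains t Z' where "finite Z'" "Z = chart t ` Z'"
proof -
  have "\<exists>q. (fst q, fst (snd q)) \<noteq> (0, 0) \<and> (fst (snd (snd q)), snd (snd (snd q))) \<noteq> (0, 0) \<and>
      P = (hcoords (fst q) (fst (snd q)), hcoords (fst (snd (snd q))) (snd (snd (snd q))))" for P :: point
    using proj_line_hcoords[of "fst P"] proj_line_hcoords[of "snd P"]
    by (metis fst_conv prod.collapse snd_conv)
  then obtain f where f: "\<And>P. (fst (f P), fst (snd (f P))) \<noteq> (0, 0)"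
    "\<And>P. (fst (snd (snd (f P))), snd (snd (snd (f P)))) \<noteq> (0, 0)"
    "\<And>P. P = (hcoords (fst (f P)) (fst (snd (f P))),
      hcoords (fst (snd (snd (f P)))) (snd (snd (snd (f P)))))"
    by metis
  \<comment> \<open>The point at infinity \<open>[1 : t]\<close> must differ from all coordinates. A
    coordinate \<open>[0 : b]\<close> contributes the quotient 0, which merely forbids
    \<open>t = 0\<close>.\<close>
  have "finite ((\<lambda>P. fst (snd (f P)) / fst (f P)) ` Z
    \<union> (\<lambda>P. snd (snd (snd (f P))) / fst (snd (snd (f P)))) ` Z)"
    using assms by simp
  then obtain t where t: "t \<notin> (\<lambda>P. fst (snd (f P)) / fst (f P)) ` Z
    \<union> (\<lambda>P. snd (snd (snd (f P))) / fst (snd (snd (f P)))) ` Z"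
    using ex_new_if_finite infinite_UNIV_char_0 by blast
  have aff: "b - t * a \<noteq> 0" if "(a, b) \<noteq> (0, 0)" "t \<noteq> b / a" for a b
    using that by (cases "a = 0") (auto simp: field_simps)
  have "\<exists>Q. P = chart t Q" if "P \<in> Z" for P
  proof -
    have tP: "t \<noteq> fst (snd (f P)) / fst (f P)" "t \<noteq> snd (snd (snd (f P))) / fst (snd (snd (f P)))"
      using t that by blast+
    obtain r where r: "hcoords (fst (f P)) (fst (snd (f P))) = hcoords r (1 + t * r)"
      using hcoords_chart[OF f(1) aff[OF f(1)], of P] tP(1) by blast
    obtain s where "hcoords (fst (snd (snd (f P)))) (snd (snd (snd (f P)))) = hcoords s (1 + t * s)"
      using hcoords_chart[OF f(2) aff[OF f(2)], of P] tP(2) by blast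
    then have "P = chart t (r, s)"
      using f(3)[of P] r by (simp add: chart_def)
    then show ?thesis ..
  qed
  then obtain h where "\<And>P. P \<in> Z \<Longrightarrow> P = chart t (h P)"
    by metis
  then have "Z = chart t ` (h ` Z)"
    by (auto simp: image_image)
  then show ?thesis
    using assms that[of "h ` Z" t] by blast
qed

text \<open>The generators of the point ideal become lines through \<open>P\<close>, and orders of
  vanishing add in products. The converse is shown only for first order, in
  \<open>homogenize_mem_point_ideal\<close>; for higher powers membership is checked on explicit
  products.\<close>

lemma vanish_dehom: "F \<in> ideal_power (point_ideal (chart t P)) m \<Longrightarrow> vanish m P (dehom t F)"
proof (induction m arbitrary: F)
  case (Suc m)
  let ?J = "point_ideal (chart t P)"
  have "?J \<subseteq> {F. vanish (Suc 0) P (dehom t F)}"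
    unfolding point_ideal_chart
  proof (rule ideal_gen_subsetI)
    show "{xform t (fst P), yform t (snd P)} \<subseteq> {F. vanish (Suc 0) P (dehom t F)}"
      by (simp add: vanish_1_iff del: ev_dehom)
  qed (auto intro: vanish_add vanish_mult_left)
  then have "{f * g |f g. f \<in> ?J \<and> g \<in> ideal_power ?J m} \<subseteq> {F. vanish (Suc m) P (dehom t F)}"
    using Suc.IH vanish_mult[of "Suc 0" P _ m] by fastforce
  then have "ideal_power ?J (Suc m) \<subseteq> {F. vanish (Suc m) P (dehom t F)}"
    unfolding ideal_power.simps by (rule ideal_gen_subsetI) (auto intro: vanish_add vanish_mult_left)
  then show ?case
    using Suc.prems by blast
qed simp

section \<open>Homogenization\<close>

text \<open>On the chart \<open>X1 - t X0\<close> takes the value 1, so it is the homogenizing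
  variable and the affine coordinate is \<open>X0 / (X1 - t X0)\<close>; likewise for
  \<open>Y0\<close> and \<open>Y1\<close>.\<close>

definition homogenize :: "complex \<Rightarrow> nat \<Rightarrow> complex bpoly \<Rightarrow> coord_ring" where
  "homogenize t k p = (\<Sum>(i, j)\<in>{..k} \<times> {..k}. Const (cf p i j) *
     ((Var X0 ^ i * (Var X1 - Const t * Var X0) ^ (k - i)) *
      (Var Y0 ^ j * (Var Y1 - Const t * Var Y0) ^ (k - j))))"

lemma form_homogenize: "form_of_bidegree k k (homogenize t k p)"
  unfolding homogenize_def
proof (rule form_sum)
  fix ij assume "ij \<in> {..k} \<times> {..k}"
  then obtain i j where ij: "ij = (i, j)" "i \<le> k" "j \<le> k"
    by auto
  have "form_of_bidegree (i * 1 + (k - i) * 1 + (j * 0 + (k - j) * 0))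
      (i * 0 + (k - i) * 0 + (j * 1 + (k - j) * 1))
      (Var X0 ^ i * (Var X1 - Const t * Var X0) ^ (k - i) *
       (Var Y0 ^ j * (Var Y1 - Const t * Var Y0) ^ (k - j)))"
    by (intro form_mult form_power form_diff form_Const_mult form_Var)
  then show "form_of_bidegree k k (case ij of (i, j) \<Rightarrow> Const (cf p i j) *
      ((Var X0 ^ i * (Var X1 - Const t * Var X0) ^ (k - i)) *
       (Var Y0 ^ j * (Var Y1 - Const t * Var Y0) ^ (k - j))))"
    using ij by (auto intro!: form_Const_mult)
qed

lemma dehom_homogenize: "bideg p k k \<Longrightarrow> dehom t (homogenize t k p) = p"
  by (rule ev_eqI) (simp add: homogenize_def eval_sum split_def ev_expand mult.assoc)

text \<open>Modulo the ideal of \<open>P = (r, s)\<close> we have \<open>X0 \<equiv> r (X1 - t X0)\<close> and \<open>Y0 \<equiv> s (Y1 - t Y0)\<close>, so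
  the homogenization of \<open>p\<close> is congruent to a multiple of \<open>p(r, s)\<close>.\<close>

lemma homogenize_mem_point_ideal:
  assumes "bideg p k k" "ev p (fst P) (snd P) = 0"
  shows "homogenize t k p \<in> point_ideal (chart t P)"
proof -
  define G where "G = {xform t (fst P), yform t (snd P)}"
  define X where "X = Var X1 - Const t * Var X0"
  define Y where "Y = Var Y1 - Const t * Var Y0"
  have pow: "A ^ n - B ^ n \<in> ideal_gen G" if "A - B \<in> ideal_gen G" for A B n
  proof (induction n)
    case (Suc n)
    have "A ^ Suc n - B ^ Suc n = A * (A ^ n - B ^ n) + B ^ n * (A - B)"
      by (simp add: algebra_simps)
    then show ?case
      using Suc that by (auto intro!: ideal_gen_add ideal_gen_mult)
  qed (simp add: ideal_gen_0)
  have mul: "A * A' - B * B' \<in> ideal_gen G" if "A - B \<in> ideal_gen G" "A' - B' \<in> ideal_gen G" for A A' B B'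
  proof -
    have "A * A' - B * B' = A * (A' - B') + B' * (A - B)"
      by (simp add: algebra_simps)
    then show ?thesis
      using that by (auto intro!: ideal_gen_add ideal_gen_mult)
  qed
  have "Var X0 - Const (fst P) * X = xform t (fst P)" "Var Y0 - Const (snd P) * Y = yform t (snd P)"
    by (simp_all add: X_def Y_def xform_def yform_def Const_add Const_mult algebra_simps)
  then have X: "Var X0 - Const (fst P) * X \<in> ideal_gen G" and Y: "Var Y0 - Const (snd P) * Y \<in> ideal_gen G"
    by (auto simp: G_def intro: ideal_gen_base)
  have refl: "A - A \<in> ideal_gen G" for A
    by (simp add: ideal_gen_0)
  define C where "C = (\<lambda>i j. Const (cf p i j) *
     (((Const (fst P) * X) ^ i * X ^ (k - i)) * ((Const (snd P) * Y) ^ j * Y ^ (k - j))))"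
  have "homogenize t k p - (\<Sum>(i, j)\<in>{..k} \<times> {..k}. C i j) = (\<Sum>(i, j)\<in>{..k} \<times> {..k}.
      Const (cf p i j) * ((Var X0 ^ i * X ^ (k - i)) * (Var Y0 ^ j * Y ^ (k - j))) - C i j)"
    by (simp add: homogenize_def X_def Y_def sum_subtractf split_def)
  also have "\<dots> \<in> ideal_gen G"
  proof (rule ideal_gen_sum)
    fix ij
    show "(case ij of (i, j) \<Rightarrow>
      Const (cf p i j) * ((Var X0 ^ i * X ^ (k - i)) * (Var Y0 ^ j * Y ^ (k - j))) - C i j) \<in> ideal_gen G"
      unfolding C_def by (cases ij) (simp, intro mul refl pow X Y)
  qed
  also have "(\<Sum>(i, j)\<in>{..k} \<times> {..k}. C i j) = 0"
  proof -
    have "C i j = Const (cf p i j * fst P ^ i * snd P ^ j) * (X ^ k * Y ^ k)" if "i \<le> k" "j \<le> k" for i j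
    proof -
      have "X ^ k = X ^ i * X ^ (k - i)" "Y ^ k = Y ^ j * Y ^ (k - j)"
        using that by (simp_all flip: power_add)
      then show ?thesis
        by (simp add: C_def Const_mult Const_power power_mult_distrib ac_simps)
    qed
    then have "(\<Sum>(i, j)\<in>{..k} \<times> {..k}. C i j)
      = (\<Sum>(i, j)\<in>{..k} \<times> {..k}. Const (cf p i j * fst P ^ i * snd P ^ j) * (X ^ k * Y ^ k))"
      by (intro sum.cong refl) auto
    also have "\<dots> = Const (ev p (fst P) (snd P)) * (X ^ k * Y ^ k)"
    proof -
      have "Const (sum g A) = (\<Sum>a\<in>A. Const (g a))" for g :: "nat \<times> nat \<Rightarrow> complex" and A
        by (induction A rule: infinite_finite_induct) (simp_all add: Const_add)
      then show ?thesis
        by (simp add: ev_expand[OF assms(1)] sum_distrib_right split_def)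
    qed
    finally show ?thesis
      using assms(2) by simp
  qed
  finally show ?thesis
    by (simp add: point_ideal_chart G_def)
qed

section \<open>The invariant\<close>

lemma radical_ideal_eq_symbolic_power: "radical_ideal (chart t ` Z) = symbolic_power (chart t ` Z) 1"
  unfolding radical_ideal_def symbolic_power_def point_ideal_chart image_image
  by (simp only: ideal_power_1_ideal_gen)

lemma alpha_star_le: "F \<in> J \<Longrightarrow> F \<noteq> 0 \<Longrightarrow> form_of_bidegree k k F \<Longrightarrow> alpha_star J \<le> k"
  unfolding alpha_star_def by (rule Least_le) blast

text \<open>\<open>LEAST\<close> is meaningful only if some form exists: the product of the
  \<open>m\<close>-th powers of the two lines through every point has equal degrees in both
  gradings.\<close>

lemma alpha_star_attained:
  assumes "finite Z"
  obtains F where "F \<in> symbolic_power (chart t ` Z) m" "F \<noteq> 0"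
    "form_of_bidegree (alpha_star (symbolic_power (chart t ` Z) m))
       (alpha_star (symbolic_power (chart t ` Z) m)) F"
proof -
  define F where "F = (\<Prod>P\<in>Z. (xform t (fst P) * yform t (snd P)) ^ m)"
  have "form_of_bidegree (card Z * (m * (1 + 0))) (card Z * (m * (0 + 1))) F"
    unfolding F_def by (intro form_prod form_power form_mult form_xform form_yform)
  then have "form_of_bidegree (card Z * m) (card Z * m) F"
    by simp
  moreover have "dehom t F \<noteq> 0"
    using assms by (simp add: F_def dehom_prod)
  then have "F \<noteq> 0"
    by auto
  moreover have "F \<in> ideal_power (point_ideal (chart t P)) m" if P: "P \<in> Z" for P
  proof -
    let ?J = "point_ideal (chart t P)"
    have "xform t (fst P) ^ m * yform t (snd P) ^ m \<in> ideal_power ?J (m + 0)"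
      by (intro ideal_power_power_mult xform_mem) auto
    then show ?thesis
      unfolding F_def using assms P
      by (subst prod.remove[of _ P]) (auto simp: power_mult_distrib intro: ideal_power_mult_right)
  qed
  then have "F \<in> symbolic_power (chart t ` Z) m"
    by (auto simp: symbolic_power_def)
  ultimately have "\<exists>k. \<exists>F\<in>symbolic_power (chart t ` Z) m. F \<noteq> 0 \<and> form_of_bidegree k k F"
    by blast
  then have "\<exists>F\<in>symbolic_power (chart t ` Z) m. F \<noteq> 0 \<and>
      form_of_bidegree (alpha_star (symbolic_power (chart t ` Z) m))
        (alpha_star (symbolic_power (chart t ` Z) m)) F"
    unfolding alpha_star_def by (rule LeastI_ex)
  then show ?thesis
    using that by blast
qed

lemma alpha_star_attained_affine:
  assumes "finite Z"
  obtains p where "p \<noteq> 0" "bideg p (alpha_star (symbolic_power (chart t ` Z) m))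
    (alpha_star (symbolic_power (chart t ` Z) m))" "\<And>P. P \<in> Z \<Longrightarrow> vanish m P p"
proof -
  obtain F where F: "F \<in> symbolic_power (chart t ` Z) m" "F \<noteq> 0"
    "form_of_bidegree (alpha_star (symbolic_power (chart t ` Z) m))
       (alpha_star (symbolic_power (chart t ` Z) m)) F"
    using alpha_star_attained[OF assms] by blast
  show ?thesis
  proof (rule that[OF dehom_nonzero[OF F(3,2), of t] bideg_dehom[OF F(3)]])
    show "vanish m P (dehom t F)" if "P \<in> Z" for P
      using F(1) that by (intro vanish_dehom) (auto simp: symbolic_power_def)
  qed
qed

lemma eval_point_ideal:
  assumes "F \<in> point_ideal (hcoords a b, hcoords c d)" "(a, b) \<noteq> (0, 0)" "(c, d) \<noteq> (0, 0)"
  shows "eval F (a, b) (c, d) = 0"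
proof -
  have "ideal_gen {Const b * Var X0 - Const a * Var X1, Const d * Var Y0 - Const c * Var Y1}
    \<subseteq> {F. eval F (a, b) (c, d) = 0}"
    by (rule ideal_gen_subsetI) simp_all
  then show ?thesis
    using assms by (auto simp: point_ideal_hcoords)
qed

section \<open>Six consecutive jumps by one\<close>

lemma alpha_star_1_of_jumps:
  fixes Z :: "point set"
  assumes "finite Z"
    and jump2: "alpha_star (symbolic_power Z 2) = alpha_star (radical_ideal Z) + 1"
    and jump6: "alpha_star (symbolic_power Z 6) = alpha_star (radical_ideal Z) + 5"
  shows "alpha_star (radical_ideal Z) = 1"
proof -
  obtain t Z' where Z': "finite Z'" and Z: "Z = chart t ` Z'"
    by (rule finite_set_in_chart[OF \<open>finite Z\<close>])
  define a where "a = alpha_star (radical_ideal Z)"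
  have rad: "radical_ideal Z = symbolic_power Z 1"
    unfolding Z by (rule radical_ideal_eq_symbolic_power)
  have a1: "alpha_star (symbolic_power (chart t ` Z') 1) = a"
    and a6: "alpha_star (symbolic_power (chart t ` Z') 6) = a + 5"
    using jump6 by (simp_all only: a_def rad flip: Z)
  \<comment> \<open>A nonzero constant vanishes nowhere, so \<open>a = 0\<close> forces
    \<open>Z\<close> to be empty; then the second symbolic power contains 1, contradicting the first
    jump.\<close>
  have "a \<noteq> 0"
  proof
    assume "a = 0"
    obtain p where p: "p \<noteq> 0" "bideg p 0 0" "\<And>P. P \<in> Z' \<Longrightarrow> vanish 1 P p"
      using alpha_star_attained_affine[OF Z', of t 1] unfolding a1 \<open>a = 0\<close> by blast
    have "Z' = {}"
    proof (rule ccontr)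
      assume "Z' \<noteq> {}"
      then obtain P where "P \<in> Z'"
        by blast
      then have "ev p (fst P) (snd P) = 0"
        using p(3) by (simp add: vanish_1_iff)
      then have "cf p 0 0 = 0"
        by (simp add: ev_expand[OF p(2)])
      then have "p = 0"
        using p(2) by (intro cf_eqI) (metis bideg_cf cf_0 le_zero_eq)
      then show False
        using p(1) by blast
    qed
    then have "alpha_star (symbolic_power Z 2) \<le> 0"
      by (intro alpha_star_le[of 1]) (simp_all add: Z symbolic_power_def form_1)
    then show False
      using jump2 by simp
  qed
  moreover have False if "a \<ge> 2"
  proof -
    obtain b where a: "a = Suc b"
      using \<open>a \<noteq> 0\<close> not0_implies_Suc by blast
    have no_curve: "p = 0" if p: "bideg p b b" "\<And>P. P \<in> Z' \<Longrightarrow> vanish (Suc 0) P p" for p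
    proof (rule ccontr)
      assume "p \<noteq> 0"
      have "homogenize t b p \<in> radical_ideal Z"
        unfolding radical_ideal_def Z using p by (auto simp: vanish_1_iff intro!: homogenize_mem_point_ideal)
      moreover have "homogenize t b p \<noteq> 0"
        using dehom_homogenize[OF p(1), of t] \<open>p \<noteq> 0\<close> by auto
      ultimately have "a \<le> b"
        unfolding a_def using form_homogenize by (rule alpha_star_le)
      then show False
        using a by simp
    qed
    obtain D where D: "D \<noteq> 0" "bideg D (a + 5) (a + 5)" "\<And>P. P \<in> Z' \<Longrightarrow> vanish 6 P D"
      using alpha_star_attained_affine[OF Z', of t 6] unfolding a6 by blast
    have "6 * Suc b \<le> 2 * (a + 5)"
      by (rule unisolvent_multiplicity_bound[OF Z' no_curve D])
    then have "a = 2"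
      using that a by simp
    then have "b = 1"
      using a by simp
    have "bideg D 7 7"
      using D(2) \<open>a = 2\<close> by simp
    then obtain x0 x1 y0 y1 where grid: "Z' \<subseteq> {x0, x1} \<times> {y0, y1}"
      using multiplicity_6_implies_grid[OF Z' no_curve[unfolded \<open>b = 1\<close>] D(1) _ D(3)] by blast
    \<comment> \<open>One vertical and one horizontal factor pass through each grid point, so four
      lines give multiplicity 2 there with bidegree only \<open>(2, 2)\<close>.\<close>
    define F where "F = xform t x0 * xform t x1 * (yform t y0 * yform t y1)"
    have "form_of_bidegree (1 + 1 + (0 + 0)) (0 + 0 + (1 + 1)) F"
      unfolding F_def by (intro form_mult form_xform form_yform)
    then have form: "form_of_bidegree 2 2 F"
      by (simp add: numeral_2_eq_2)
    have "dehom t F \<noteq> 0"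
      by (simp add: F_def)
    then have "F \<noteq> 0"
      by auto
    moreover have "F \<in> ideal_power (point_ideal (chart t P)) 2" if "P \<in> Z'" for P
    proof -
      have "P \<in> {x0, x1} \<times> {y0, y1}"
        using that grid by blast
      then obtain x y where P: "P = (x, y)" "x \<in> {x0, x1}" "y \<in> {y0, y1}"
        by (rule SigmaE)
      let ?J = "point_ideal (chart t P)"
      have "xform t x ^ 1 * yform t y ^ 1 \<in> ideal_power ?J (1 + (1 + 0))"
        using ideal_power_power_mult[OF yform_mem, of P y 1 t 0 1]
        by (intro ideal_power_power_mult xform_mem) (simp_all add: P(1))
      then have mem: "xform t x * yform t y \<in> ideal_power ?J 2"
        by (simp only: power_one_right one_add_one add_0_right)
      have "xform t x * yform t y dvd F"
        unfolding F_def using P(2,3) by (intro mult_dvd_mono) auto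
      then show ?thesis
        using ideal_power_mult_right[OF mem] by (auto elim: dvdE)
    qed
    then have "F \<in> symbolic_power Z 2"
      by (auto simp: symbolic_power_def Z)
    ultimately have "alpha_star (symbolic_power Z 2) \<le> 2"
      using form by (intro alpha_star_le[of F])
    then show False
      using jump2 \<open>a = 2\<close> by (simp add: a_def)
  qed
  ultimately show ?thesis
    unfolding a_def by fastforce
qed

lemma contained_in_divisor_alpha_star:
  assumes "finite Z"
  shows "contained_in_divisor Z (alpha_star (radical_ideal Z)) (alpha_star (radical_ideal Z))"
proof -
  obtain t Z' where Z': "finite Z'" and Z: "Z = chart t ` Z'"
    by (rule finite_set_in_chart[OF assms])
  have rad: "radical_ideal Z = symbolic_power Z 1"
    unfolding Z by (rule radical_ideal_eq_symbolic_power)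
  obtain F where F: "F \<in> radical_ideal Z" "F \<noteq> 0"
    "form_of_bidegree (alpha_star (radical_ideal Z)) (alpha_star (radical_ideal Z)) F"
    using alpha_star_attained[OF Z', of t 1, folded Z, folded rad] by blast
  moreover have "vanishes_at F P" if "P \<in> Z" for P
    unfolding vanishes_at_def
  proof (intro allI impI, elim conjE)
    fix a b c d assume "(a, b) \<noteq> (0, 0)" "(c, d) \<noteq> (0, 0)" "P = (hcoords a b, hcoords c d)"
    then show "eval F (a, b) (c, d) = 0"
      using F(1) that by (intro eval_point_ideal) (auto simp: radical_ideal_def)
  qed
  ultimately show ?thesis
    unfolding contained_in_divisor_def by blast
qed

section \<open>A set with five consecutive jumps\<close>

text \<open>The points \<open>(0, 0), (0, 1), (1, 0), (1, 2)\<close>. The lines \<open>x = 0\<close>, \<open>x = 1\<close> and \<open>y = 0\<close> contain two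
  of them each, and \<open>diag\<close> is the curve \<open>y = x + 1\<close> through the second and the fourth one.\<close>

definition witness :: "(complex \<times> complex) set" where
  "witness = {(0, 0), (0, 1), (1, 0), (1, 2)}"

lemma finite_witness: "finite witness"
  by (simp add: witness_def)

definition diag :: coord_ring where
  "diag = Var Y0 * Var X1 - Var Y1 * Var X1 - Var X0 * Var Y1"

definition witness_form :: "nat \<Rightarrow> nat \<Rightarrow> nat \<Rightarrow> nat \<Rightarrow> nat \<Rightarrow> nat \<Rightarrow> coord_ring" where
  "witness_form a b c d e f =
     xform 0 0 ^ a * xform 0 1 ^ b * (yform 0 0 ^ c * yform 0 1 ^ d * yform 0 2 ^ e * diag ^ f)"

lemma form_witness_form: "form_of_bidegree (a + b + f) (c + d + e + f) (witness_form a b c d e f)"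
proof -
  have "form_of_bidegree (1 + 0) (0 + 1) diag"
    unfolding diag_def using form_mult[OF form_Var(2) form_Var(3)] form_mult[OF form_Var(2) form_Var(4)]
      form_mult[OF form_Var(1) form_Var(4)] by (auto simp: mult.commute intro!: form_diff)
  then have "form_of_bidegree (a * 1 + b * 1 + (c * 0 + d * 0 + e * 0 + f * (1 + 0)))
      (a * 0 + b * 0 + (c * 1 + d * 1 + e * 1 + f * (0 + 1))) (witness_form a b c d e f)"
    unfolding witness_form_def by (intro form_mult form_power form_xform form_yform)
  then show ?thesis
    by (simp add: add.assoc)
qed

lemma witness_form_nonzero: "witness_form a b c d e f \<noteq> 0"
proof -
  have "ev (dehom 0 diag) 0 0 \<noteq> 0"
    by (simp add: diag_def)
  then have "dehom 0 diag \<noteq> 0"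
    by (metis ev_0)
  then have "dehom 0 (witness_form a b c d e f) \<noteq> 0"
    by (simp add: witness_form_def)
  then show ?thesis
    by auto
qed

lemma diag_mem: "diag \<in> point_ideal (chart 0 (0, 1))" "diag \<in> point_ideal (chart 0 (1, 2))"
proof -
  have mem: "A * xform 0 (fst P) + B * yform 0 (snd P) \<in> point_ideal (chart 0 P)" for A B P
    unfolding point_ideal_chart by (intro ideal_gen_add ideal_gen_mult ideal_gen_base) auto
  have "diag = (- Var Y1) * xform 0 0 + Var X1 * yform 0 1"
    by (simp add: diag_def xform_def yform_def algebra_simps)
  then show "diag \<in> point_ideal (chart 0 (0, 1))"
    using mem[of "- Var Y1" "(0, 1)" "Var X1"] by simp
  have "Const 2 = 2"
    using Const_add[of 1 1] by simp
  then have "diag = (- Var Y1) * xform 0 1 + Var X1 * yform 0 2"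
    by (simp add: diag_def xform_def yform_def algebra_simps)
  then show "diag \<in> point_ideal (chart 0 (1, 2))"
    using mem[of "- Var Y1" "(1, 2)" "Var X1"] by simp
qed

lemma power3_mem:
  assumes "f \<in> J" "g \<in> J" "h \<in> J" "m \<le> i + j + k"
  shows "f ^ i * (g ^ j * h ^ k) \<in> ideal_power J m"
proof -
  have "f ^ i * (g ^ j * (h ^ k * 1)) \<in> ideal_power J (i + (j + (k + 0)))"
    by (intro ideal_power_power_mult assms) simp
  then show ?thesis
    using ideal_power_antimono[of m "i + (j + (k + 0))" J] assms(4) by auto
qed

text \<open>Each inequality adds up the exponents of the factors through one point, in the order
  \<open>(0, 0)\<close>, \<open>(0, 1)\<close>, \<open>(1, 0)\<close>, \<open>(1, 2)\<close>;
  \<open>diag\<close> counts at the second and the fourth.\<close>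

lemma witness_form_mem:
  assumes "m \<le> a + c" "m \<le> a + d + f" "m \<le> b + c" "m \<le> b + e + f"
  shows "witness_form a b c d e f \<in> symbolic_power (chart 0 ` witness) m"
proof -
  let ?J = "\<lambda>P. point_ideal (chart 0 P)"
  have "xform 0 0 ^ a * (yform 0 0 ^ c * yform 0 0 ^ 0) \<in> ideal_power (?J (0, 0)) m"
    "xform 0 0 ^ a * (yform 0 1 ^ d * diag ^ f) \<in> ideal_power (?J (0, 1)) m"
    "xform 0 1 ^ b * (yform 0 0 ^ c * yform 0 0 ^ 0) \<in> ideal_power (?J (1, 0)) m"
    "xform 0 1 ^ b * (yform 0 2 ^ e * diag ^ f) \<in> ideal_power (?J (1, 2)) m"
    using assms by (intro power3_mem xform_mem yform_mem diag_mem; simp)+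
  note this[THEN ideal_power_mult_right]
  note this(1)[of "xform 0 1 ^ b * (yform 0 1 ^ d * yform 0 2 ^ e * diag ^ f)"]
    this(2)[of "xform 0 1 ^ b * (yform 0 0 ^ c * yform 0 2 ^ e)"]
    this(3)[of "xform 0 0 ^ a * (yform 0 1 ^ d * yform 0 2 ^ e * diag ^ f)"]
    this(4)[of "xform 0 0 ^ a * (yform 0 0 ^ c * yform 0 1 ^ d)"]
  then show ?thesis
    unfolding symbolic_power_def witness_def witness_form_def by (simp add: ac_simps)
qed

lemma witness_no_curve:
  assumes "0 < m" "m \<le> 5" "bideg p m m" "\<And>P. P \<in> witness \<Longrightarrow> vanish m P p"
  shows "p = 0"
proof (rule ccontr)
  assume "p \<noteq> 0"
  then have "admits m m [((0, 0), m), ((0, 1), m), ((1, 0), m), ((1, 2), m)]"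
    using assms(3,4) unfolding admits_def by (intro exI[of _ p]) (auto simp: witness_def)
  then show False
    using path4_not_admits_diagonal[of 0 1 0 1 2 m] assms(1,2) by simp
qed

lemma alpha_star_witness:
  assumes "0 < m" "m \<le> 5"
  shows "alpha_star (symbolic_power (chart 0 ` witness) m) = m + 1"
proof (rule antisym)
  obtain p where p: "p \<noteq> 0" "bideg p (alpha_star (symbolic_power (chart 0 ` witness) m))
    (alpha_star (symbolic_power (chart 0 ` witness) m))" "\<And>P. P \<in> witness \<Longrightarrow> vanish m P p"
    using alpha_star_attained_affine[OF finite_witness] by blast
  have "\<not> alpha_star (symbolic_power (chart 0 ` witness) m) \<le> m"
    using witness_no_curve[OF assms bideg_mono[OF p(2)] p(3)] p(1) by blast
  then show "m + 1 \<le> alpha_star (symbolic_power (chart 0 ` witness) m)"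
    by simp
  have upper: "alpha_star (symbolic_power (chart 0 ` witness) m) \<le> m + 1"
    if "m \<le> a + c" "m \<le> a + d + f" "m \<le> b + c" "m \<le> b + e + f"
      "a + b + f = m + 1" "c + d + e + f = m + 1" for a b c d e f
    using witness_form_mem[OF that(1-4)] witness_form_nonzero form_witness_form[of a b f c d e] that(5,6)
    by (intro alpha_star_le) auto
  have "m = 1 \<or> m = 2 \<or> m = 3 \<or> m = 4 \<or> m = 5"
    using assms by linarith
  \<comment> \<open>The arguments of \<open>upper\<close> follow the first occurrences in its
    premises, \<open>a c d f b e\<close>. For \<open>m = 5\<close>, say, this is three times each
    vertical line and twice each of the three horizontal lines; only the choice for
    \<open>m = 4\<close> contains \<open>diag\<close>.\<close>
  then show "alpha_star (symbolic_power (chart 0 ` witness) m) \<le> m + 1"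
    using upper[of 1 2 0 0 1 0] upper[of 2 1 1 0 1 1] upper[of 2 2 1 0 2 1] upper[of 2 2 1 1 2 1]
      upper[of 3 2 2 0 3 2] by auto
qed

lemma witness_not_contained: "\<not> contained_in_divisor (chart 0 ` witness) 1 1"
proof
  assume "contained_in_divisor (chart 0 ` witness) 1 1"
  then obtain F where F: "F \<noteq> 0" "form_of_bidegree 1 1 F" "\<And>P. P \<in> witness \<Longrightarrow> vanishes_at F (chart 0 P)"
    unfolding contained_in_divisor_def by auto
  have "vanish 1 P (dehom 0 F)" if "P \<in> witness" for P
    using F(3)[OF that] by (simp add: vanish_1_iff vanishes_at_def chart_def)
  then have "dehom 0 F = 0"
    using witness_no_curve[of 1 "dehom 0 F"] bideg_dehom[OF F(2)] by simp
  then show False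
    using dehom_nonzero[OF F(2,1)] by blast
qed

theorem theorem2p10:
  shows "(\<forall>Z :: point set. finite Z \<longrightarrow>
            alpha_star (symbolic_power Z 6) = alpha_star (symbolic_power Z 5) + 1 \<and>
            alpha_star (symbolic_power Z 5) + 1 = alpha_star (symbolic_power Z 4) + 2 \<and>
            alpha_star (symbolic_power Z 4) + 2 = alpha_star (symbolic_power Z 3) + 3 \<and>
            alpha_star (symbolic_power Z 3) + 3 = alpha_star (symbolic_power Z 2) + 4 \<and>
            alpha_star (symbolic_power Z 2) + 4 = alpha_star (radical_ideal Z) + 5 \<longrightarrow>
            alpha_star (radical_ideal Z) = 1 \<and> contained_in_divisor Z 1 1)
       \<and> (\<exists>Z :: point set. finite Z \<and>
            alpha_star (symbolic_power Z 5) = alpha_star (symbolic_power Z 4) + 1 \<and>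
            alpha_star (symbolic_power Z 4) + 1 = alpha_star (symbolic_power Z 3) + 2 \<and>
            alpha_star (symbolic_power Z 3) + 2 = alpha_star (symbolic_power Z 2) + 3 \<and>
            alpha_star (symbolic_power Z 2) + 3 = alpha_star (radical_ideal Z) + 4 \<and>
            \<not> contained_in_divisor Z 1 1)"
proof (intro conjI allI impI)
  fix Z :: "point set"
  assume "finite Z" and "alpha_star (symbolic_power Z 6) = alpha_star (symbolic_power Z 5) + 1 \<and>
            alpha_star (symbolic_power Z 5) + 1 = alpha_star (symbolic_power Z 4) + 2 \<and>
            alpha_star (symbolic_power Z 4) + 2 = alpha_star (symbolic_power Z 3) + 3 \<and>
            alpha_star (symbolic_power Z 3) + 3 = alpha_star (symbolic_power Z 2) + 4 \<and>
            alpha_star (symbolic_power Z 2) + 4 = alpha_star (radical_ideal Z) + 5"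
  then show "alpha_star (radical_ideal Z) = 1"
    by (intro alpha_star_1_of_jumps) linarith+
  then show "contained_in_divisor Z 1 1"
    using contained_in_divisor_alpha_star[OF \<open>finite Z\<close>] by simp
next
  show "\<exists>Z :: point set. finite Z \<and>
            alpha_star (symbolic_power Z 5) = alpha_star (symbolic_power Z 4) + 1 \<and>
            alpha_star (symbolic_power Z 4) + 1 = alpha_star (symbolic_power Z 3) + 2 \<and>
            alpha_star (symbolic_power Z 3) + 2 = alpha_star (symbolic_power Z 2) + 3 \<and>
            alpha_star (symbolic_power Z 2) + 3 = alpha_star (radical_ideal Z) + 4 \<and>
            \<not> contained_in_divisor Z 1 1"
    using alpha_star_witness[of 1] alpha_star_witness[of 2] alpha_star_witness[of 3]
      alpha_star_witness[of 4] alpha_star_witness[of 5] witness_not_contained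
    by (intro exI[of _ "chart 0 ` witness"])
      (simp add: radical_ideal_eq_symbolic_power finite_witness)
qed

end
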